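(* $\mathrm{NE}^{ap}_{\mathcal{O}\cup\mathcal{A}}\equiv_W\mathrm{C}_{\{0,1\}^\mathbb{N}}\times\mathrm{LPO}^*$.
   Context: $f\leq_W g$ iff there are computable partial $K,H$ on $\mathbb{N}^\mathbb{N}$ such that for every realizer $G$ of $g$, $p\mapsto K(\langle p,G(H(p))\rangle)$ realizes $f$; $\equiv_W$ induced equivalence. $\times$ product; $f^*$: $f^0=\mathrm{id}$, $f^{n+1}=f\times f^n$, $f^*(n,x)=f^n(x)$. $\mathrm{LPO}:\{0,1\}^\mathbb{N}\to\{0,1\}$ outputs $1$ iff $p=0^\mathbb{N}$. $\mathcal{O}$: open subsets of $\{0,1\}^\mathbb{N}$, named by enumerations of words $w$ with $U=\bigcup w\{0,1\}^\mathbb{N}$; $\mathcal{A}$: closed sets, named by names of their complements; $\mathcal{O}\cup\mathcal{A}$: named by a tag plus such a name. $\mathrm{C}_{\{0,1\}^\mathbb{N}}$ maps a nonempty closed set to any of its elements. Games: two-player infinite sequential games with choices $\{0,1\}$, turn function $d:\{0,1\}^*\to\{1,2\}$, finitely many outcomes, valuation $v:\{0,1\}^\mathbb{N}\to O$, linear preferences with $\prec_1=\prec_2^{-1}$ (antagonistic). Strategy profiles $s:\{0,1\}^*\to\{0,1\}$; induced play $p_n=s(p_{<n})$; Nash equilibrium: no player can unilaterally change strategy to get a strictly preferred outcome. $\mathrm{NE}^{ap}_\Gamma$ takes such a game, named by the number of outcomes, $d$ and preferences as tables, and for each player and each upper set $U$ of outcomes w.r.t. its preference a $\Gamma$-name of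 $v^{-1}(U)$, and outputs any Nash equilibrium. *)

theory Defs
  imports Main "HOL-Library.Nat_Bijection" "HOL-Library.Sublist"
begin

datatype recf = Zero | Succ | Proj nat | Comp recf "recf list" | Prim recf recf | Mu recf

definition getarg :: "nat \<Rightarrow> nat list \<Rightarrow> nat" where
  "getarg i xs = (if i < length xs then xs ! i else 0)"

inductive eval :: "recf \<Rightarrow> nat list \<Rightarrow> nat \<Rightarrow> bool" where
  eval_Zero: "eval Zero xs 0"
| eval_Succ: "eval Succ xs (Suc (getarg 0 xs))"
| eval_Proj: "eval (Proj i) xs (getarg i xs)"
| eval_Comp: "list_all2 (\<lambda>g y. eval g xs y) gs ys \<Longrightarrow> eval f ys z \<Longrightarrow> eval (Comp f gs) xs z"
| eval_Prim0: "eval f xs z \<Longrightarrow> eval (Prim f g) (0 # xs) z"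
| eval_PrimS: "eval (Prim f g) (n # xs) y \<Longrightarrow> eval g (n # y # xs) z
      \<Longrightarrow> eval (Prim f g) (Suc n # xs) z"
| eval_Mu: "eval f (n # xs) 0 \<Longrightarrow> (\<forall>m<n. \<exists>y. eval f (m # xs) (Suc y))
      \<Longrightarrow> eval (Mu f) xs n"

type_synonym baire = "nat \<Rightarrow> nat"

text \<open>The machine given by the partial recursive program e reads the input prefixes
  (coded by list_encode) and writes output words; it computes q from p if on every input
  prefix it halts, the outputs grow monotonically (w.r.t. prefix order) and their limit is
  the infinite sequence q.\<close>
definition machine_out :: "recf \<Rightarrow> baire \<Rightarrow> baire \<Rightarrow> bool" where
  "machine_out e p q \<longleftrightarrow>
     (\<forall>n. \<exists>y. eval e [list_encode (map p [0..<n])] y) \<and>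
     (\<forall>n y y'. eval e [list_encode (map p [0..<n])] y \<longrightarrow>
               eval e [list_encode (map p [0..<Suc n])] y' \<longrightarrow>
               prefix (list_decode y) (list_decode y')) \<and>
     (\<forall>k. \<exists>n y. eval e [list_encode (map p [0..<n])] y \<and>
               k < length (list_decode y) \<and> list_decode y ! k = q k)"

definition bpair :: "baire \<Rightarrow> baire \<Rightarrow> baire" where
  "bpair p q = (\<lambda>n. if even n then p (n div 2) else q (n div 2))"

definition bfst :: "baire \<Rightarrow> baire" where "bfst p = (\<lambda>n. p (2 * n))"
definition bsnd :: "baire \<Rightarrow> baire" where "bsnd p = (\<lambda>n. p (2 * n + 1))"

text \<open>A problem is given on names: P p q means that q is a name of an admissible
  output for the instance named by p.\<close>
type_synonym problem = "baire \<Rightarrow> baire \<Rightarrow> bool"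

definition pdom :: "problem \<Rightarrow> baire set" where
  "pdom P = {p. \<exists>q. P p q}"

definition realizer :: "problem \<Rightarrow> (baire \<Rightarrow> baire) \<Rightarrow> bool" where
  "realizer P G \<longleftrightarrow> (\<forall>p \<in> pdom P. P p (G p))"

definition weihrauch_le :: "problem \<Rightarrow> problem \<Rightarrow> bool" (infix "\<le>\<^sub>W" 50) where
  "f \<le>\<^sub>W g \<longleftrightarrow> (\<exists>eH eK. \<forall>G. realizer g G \<longrightarrow>
      (\<forall>p \<in> pdom f. \<exists>h. machine_out eH p h \<and> h \<in> pdom g \<and>
          (\<exists>r. machine_out eK (bpair p (G h)) r \<and> f p r)))"

definition weihrauch_eq :: "problem \<Rightarrow> problem \<Rightarrow> bool" (infix "\<equiv>\<^sub>W" 50) where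
  "f \<equiv>\<^sub>W g \<longleftrightarrow> f \<le>\<^sub>W g \<and> g \<le>\<^sub>W f"

definition pprod :: "problem \<Rightarrow> problem \<Rightarrow> problem" (infixr "\<times>\<^sub>W" 70) where
  "(f \<times>\<^sub>W g) p q \<longleftrightarrow> f (bfst p) (bfst q) \<and> g (bsnd p) (bsnd q)"

text \<open>f^0 = id (on the one-point space, every sequence is a name), f^(n+1) = f \<times> f^n.\<close>
fun ppow :: "problem \<Rightarrow> nat \<Rightarrow> problem" where
  "ppow f 0 = (\<lambda>p q. True)"
| "ppow f (Suc n) = f \<times>\<^sub>W ppow f n"

definition pstar :: "problem \<Rightarrow> problem" where
  "pstar f p q \<longleftrightarrow> ppow f (p 0) (\<lambda>k. p (Suc k)) q"

definition cantor :: "baire \<Rightarrow> bool" where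
  "cantor x \<longleftrightarrow> (\<forall>n. x n \<le> 1)"

definition bword :: "nat list \<Rightarrow> bool" where
  "bword w \<longleftrightarrow> set w \<subseteq> {0, 1}"

definition extends :: "baire \<Rightarrow> nat list \<Rightarrow> bool" where
  "extends x w \<longleftrightarrow> (\<forall>i < length w. x i = w ! i)"

text \<open>Name of an open set: an enumeration of (codes of) words, where entry 0 means
  ``nothing'' and entry Suc c means the word list_decode c.\<close>
definition opn :: "baire \<Rightarrow> baire set" where
  "opn r = {x. cantor x \<and> (\<exists>n c. r n = Suc c \<and> extends x (list_decode c))}"

definition cls :: "baire \<Rightarrow> baire set" where
  "cls r = {x. cantor x} - opn r"

definition OA_name :: "baire \<Rightarrow> baire set \<Rightarrow> bool" where
  "OA_name r S \<longleftrightarrow> (r 0 = 0 \<and> S = opn (\<lambda>n. r (Suc n))) \<or>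
                    (r 0 = 1 \<and> S = cls (\<lambda>n. r (Suc n)))"

definition C_cantor :: problem where
  "C_cantor p q \<longleftrightarrow> cls p \<noteq> {} \<and> q \<in> cls p"

definition LPO :: problem where
  "LPO p q \<longleftrightarrow> cantor p \<and> q 0 = (if p = (\<lambda>_. 0) then 1 else 0)"

definition bcomp :: "nat \<Rightarrow> baire \<Rightarrow> baire" where
  "bcomp k p = (\<lambda>n. p (prod_encode (k, n)))"

definition setcode :: "nat set \<Rightarrow> nat" where
  "setcode U = (\<Sum>i\<in>U. 2 ^ i)"

definition strict_linear :: "nat \<Rightarrow> (nat \<Rightarrow> nat \<Rightarrow> bool) \<Rightarrow> bool" where
  "strict_linear m r \<longleftrightarrow>
     (\<forall>i j. r i j \<longrightarrow> i < m \<and> j < m) \<and> (\<forall>i. \<not> r i i) \<and>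
     (\<forall>i j k. r i j \<longrightarrow> r j k \<longrightarrow> r i k) \<and>
     (\<forall>i<m. \<forall>j<m. i \<noteq> j \<longrightarrow> r i j \<or> r j i)"

definition upper :: "nat \<Rightarrow> (nat \<Rightarrow> nat \<Rightarrow> bool) \<Rightarrow> nat set \<Rightarrow> bool" where
  "upper m r U \<longleftrightarrow> U \<subseteq> {..<m} \<and> (\<forall>o1 o2. o1 \<in> U \<longrightarrow> r o1 o2 \<longrightarrow> o2 \<in> U)"

fun play_prefix :: "(nat list \<Rightarrow> nat) \<Rightarrow> nat \<Rightarrow> nat list" where
  "play_prefix s 0 = []"
| "play_prefix s (Suc n) = play_prefix s n @ [s (play_prefix s n)]"

definition play :: "(nat list \<Rightarrow> nat) \<Rightarrow> baire" where
  "play s = (\<lambda>n. s (play_prefix s n))"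

definition strategy :: "(nat list \<Rightarrow> nat) \<Rightarrow> bool" where
  "strategy s \<longleftrightarrow> (\<forall>w. bword w \<longrightarrow> s w \<le> 1)"

text \<open>r a i j: player a strictly prefers outcome j to outcome i.\<close>
definition nash :: "(nat list \<Rightarrow> nat) \<Rightarrow> (nat \<Rightarrow> nat \<Rightarrow> nat \<Rightarrow> bool) \<Rightarrow> (baire \<Rightarrow> nat)
                    \<Rightarrow> (nat list \<Rightarrow> nat) \<Rightarrow> bool" where
  "nash d r v s \<longleftrightarrow> strategy s \<and>
     (\<forall>a \<in> {1, 2}. \<forall>s'. strategy s' \<longrightarrow> (\<forall>w. bword w \<and> d w \<noteq> a \<longrightarrow> s' w = s w) \<longrightarrow>
        \<not> r a (v (play s)) (v (play s')))"

text \<open>p is a name of the antagonistic game with m outcomes 0..m-1, turn function d,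
  preferences r 1, r 2 and valuation v.\<close>
definition game_name :: "baire \<Rightarrow> nat \<Rightarrow> (nat list \<Rightarrow> nat) \<Rightarrow> (nat \<Rightarrow> nat \<Rightarrow> nat \<Rightarrow> bool)
                          \<Rightarrow> (baire \<Rightarrow> nat) \<Rightarrow> bool" where
  "game_name p m d r v \<longleftrightarrow>
     m = bcomp 0 p 0 \<and> 1 \<le> m \<and>
     (\<forall>w. bword w \<longrightarrow> d w = bcomp 1 p (list_encode w) \<and> d w \<in> {1, 2}) \<and>
     (\<forall>a \<in> {1, 2}. \<forall>i<m. \<forall>j<m. bcomp (a + 1) p (prod_encode (i, j)) \<le> 1) \<and>
     (\<forall>a \<in> {1, 2}. \<forall>i j. r a i j \<longleftrightarrow>
         i < m \<and> j < m \<and> bcomp (a + 1) p (prod_encode (i, j)) = 1) \<and>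
     strict_linear m (r 1) \<and> (\<forall>i j. r 2 i j \<longleftrightarrow> r 1 j i) \<and>
     (\<forall>x. cantor x \<longrightarrow> v x < m) \<and>
     (\<forall>a \<in> {1, 2}. \<forall>U. upper m (r a) U \<longrightarrow>
         OA_name (bcomp (prod_encode (a, setcode U)) (bcomp 4 p)) {x. cantor x \<and> v x \<in> U})"

definition NE_ap_OA :: problem where
  "NE_ap_OA p q \<longleftrightarrow> (\<exists>m d r v. game_name p m d r v \<and>
      nash d r v (\<lambda>w. q (list_encode w)))"

end

theory Submission
  imports Defs
begin

text \<open>An antagonistic game has a value: the best outcome o that player 1 can guarantee. Whether
  player 1 can guarantee at least k is a win/lose game that is open for one of the players, so a finite
  tree witnesses a win of that player, which one instance of LPO per outcome detects. The winning
  strategies of the other player form a closed set. To have a nonempty closed set even if that player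
  loses, a word is only forbidden once some finite part of a strategy is seen to avoid it and all
  earlier words. Two optimal strategies, one for the threshold o and one for the next outcome, form an
  equilibrium; those of the closed player are read off the solution of closed choice, those of the
  open player off the finite tree.

  Conversely, let player 1 claim a number j, and let player 2 answer with a point. Player 1 gets the best
  outcome if the point is not in the given closed set, and otherwise j, provided that at least j of the
  given sequences are not zero. In an equilibrium the claim is the exact number of nonzero sequences, which
  tells for how many of them to wait, and the answer is in the closed set.\<close>

section \<open>Primitive recursive functionals of an oracle\<close>

text \<open>\<open>machine_out\<close> wants a program that halts on every input prefix, so a
  computation that may have to wait cannot be run as it is. It is replaced by primitive recursive
  approximations that answer 0 until the prefix suffices, and all unbounded waiting becomes a search
  for a finite certificate. In both reductions the inner machine is total, and the outer one
  searches for a certificate before it writes. The game built from \<open>p\<close> has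
  \<open>lnum p + 3\<close> outcomes: 0 for an endless claim, or an unsupported one answered inside
  the closed set; \<open>Suc j\<close> for a supported claim \<open>j \<le> lnum p\<close>; and
  \<open>lnum p + 2\<close> for an answer outside the closed set. The end of a claim, its support
  and an escape from the closed set all show after finite time. So each set of plays of value at
  least \<open>i\<close> is open, and one enumeration serves player 1 with the open tag and player
  2, for the complement, with the closed tag. In the other direction, positions won by the open
  player are defined through finite trees from the start. Such trees are closed under union and
  under adding a node, which replaces ranks and compactness in the proof of determinacy.\<close>

inductive_cases eval_ZeroE: "eval Zero xs y"
inductive_cases eval_SuccE: "eval Succ xs y"
inductive_cases eval_ProjE: "eval (Proj i) xs y"
inductive_cases eval_CompE: "eval (Comp f gs) xs y"
inductive_cases eval_Prim0E: "eval (Prim f g) (0 # xs) y"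
inductive_cases eval_PrimSE: "eval (Prim f g) (Suc n # xs) y"
inductive_cases eval_MuE: "eval (Mu f) xs y"

text \<open>\<open>machine_out\<close> speaks of all \<open>y\<close> related by
  \<open>eval\<close>; uniqueness lets one exhibited value stand for all of them.\<close>

lemma eval_deterministic: "eval e xs y \<Longrightarrow> eval e xs y' \<Longrightarrow> y' = y"
proof (induction arbitrary: y' rule: eval.induct)
  case (eval_Zero xs)
  then show ?case by (auto elim: eval_ZeroE)
next
  case (eval_Succ xs)
  then show ?case by (auto elim: eval_SuccE)
next
  case (eval_Proj i xs)
  then show ?case by (auto elim: eval_ProjE)
next
  case (eval_Comp xs gs ys f z)
  from eval_Comp.prems obtain ys' where
    "list_all2 (\<lambda>g y. eval g xs y) gs ys'" and e: "eval f ys' y'"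
    by (rule eval_CompE)
  then have "ys' = ys"
    using eval_Comp.IH(1) unfolding list_all2_conv_all_nth by (metis nth_equalityI)
  with e have "eval f ys y'" by simp
  then show ?case by (rule eval_Comp.IH(2))
next
  case (eval_Prim0 f xs z g)
  from eval_Prim0.prems have "eval f xs y'" by (rule eval_Prim0E)
  then show ?case by (rule eval_Prim0.IH)
next
  case (eval_PrimS f g n xs y z)
  from eval_PrimS.prems obtain u where u: "eval (Prim f g) (n # xs) u" "eval g (n # u # xs) y'"
    by (rule eval_PrimSE)
  from u(1) have "u = y" by (rule eval_PrimS.IH(1))
  with u(2) have "eval g (n # y # xs) y'" by simp
  then show ?case by (rule eval_PrimS.IH(2))
next
  case (eval_Mu f n xs)
  from eval_Mu.prems obtain y': "eval f (y' # xs) 0" "\<forall>m<y'. \<exists>y. eval f (m # xs) (Suc y)"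
    by (rule eval_MuE)
  show ?case
  proof (rule linorder_cases[of y' n])
    assume "y' < n"
    with eval_Mu.IH(2) y'(1) show ?thesis by blast
  next
    assume "n < y'"
    with y'(2) eval_Mu.IH(1) show ?thesis by fastforce
  qed
qed

text \<open>Three arguments suffice: a recursion hands its step a counter, an accumulated value and
  one parameter, and further data are packed with \<open>pair\<close>.\<close>

definition pr3 :: "(nat \<Rightarrow> nat \<Rightarrow> nat \<Rightarrow> nat) \<Rightarrow> bool" where
  "pr3 F \<longleftrightarrow> (\<exists>e. \<forall>x y z. eval e [x, y, z] (F x y z))"

lemma pr3_proj:
  "pr3 (\<lambda>x y z. x)" "pr3 (\<lambda>x y z. y)" "pr3 (\<lambda>x y z. z)"
proof -
  have "eval (Proj i) [x, y, z] ([x, y, z] ! i)" if "i < 3" for i x y z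
    using eval_Proj[of i "[x, y, z]"] that by (simp add: getarg_def)
  from this[of 0] this[of 1] this[of 2] show
    "pr3 (\<lambda>x y z. x)" "pr3 (\<lambda>x y z. y)" "pr3 (\<lambda>x y z. z)"
    unfolding pr3_def by (auto simp: numeral_2_eq_2)
qed

lemma pr3_comp:
  assumes "pr3 F" "pr3 A" "pr3 B" "pr3 D"
  shows "pr3 (\<lambda>x y z. F (A x y z) (B x y z) (D x y z))"
proof -
  from assms obtain f a b d where
    "\<And>x y z. eval f [x, y, z] (F x y z)" "\<And>x y z. eval a [x, y, z] (A x y z)"
    "\<And>x y z. eval b [x, y, z] (B x y z)" "\<And>x y z. eval d [x, y, z] (D x y z)"
    unfolding pr3_def by metis
  then have "eval (Comp f [a, b, d]) [x, y, z] (F (A x y z) (B x y z) (D x y z))" for x y z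
    by (intro eval_Comp[where ys = "[A x y z, B x y z, D x y z]"]) auto
  then show ?thesis unfolding pr3_def by blast
qed

lemma pr3_zero: "pr3 (\<lambda>x y z. 0)"
  unfolding pr3_def using eval_Zero by blast

lemma pr3_Suc:
  assumes "pr3 A" shows "pr3 (\<lambda>x y z. Suc (A x y z))"
proof -
  have "pr3 (\<lambda>x y z. Suc x)"
    unfolding pr3_def using eval_Succ[of "[_, _, _]"] by (auto simp: getarg_def)
  then show ?thesis using pr3_comp assms by blast
qed

text \<open>\<open>Prim\<close> evaluates its step on \<open>[i, r, x]\<close>, which fits the arity
  of \<open>pr3\<close>, but its base on \<open>[x]\<close>; the base is padded by repeating the
  parameter.\<close>

lemma pr3_rec_aux:
  assumes "pr3 A" "pr3 B"
  shows "pr3 (\<lambda>x y z. rec_nat (A x x x) (\<lambda>i r. B i r x) y)"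
proof -
  from assms obtain a b where
    a: "\<And>x y z. eval a [x, y, z] (A x y z)" and b: "\<And>x y z. eval b [x, y, z] (B x y z)"
    unfolding pr3_def by metis
  define e where "e = Prim (Comp a [Proj 0, Proj 0, Proj 0]) b"
  have arg: "eval (Proj 0) (x # xs) x" "eval (Proj 1) (y # x # xs) x" for x y xs
    using eval_Proj[of 0 "x # xs"] eval_Proj[of 1 "y # x # xs"] by (auto simp: getarg_def)
  have "eval e [y, x] (rec_nat (A x x x) (\<lambda>i r. B i r x) y)" for x y
  proof (induction y)
    case 0
    have "eval (Comp a [Proj 0, Proj 0, Proj 0]) [x] (A x x x)"
      by (rule eval_Comp[where ys = "[x, x, x]"]) (auto intro: arg a)
    then show ?case unfolding e_def by (auto intro: eval_Prim0)
  next
    case (Suc y)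
    then show ?case
      using b unfolding e_def by (auto intro: eval_PrimS)
  qed
  then have "eval (Comp e [Proj 1, Proj 0]) [x, y, z] (rec_nat (A x x x) (\<lambda>i r. B i r x) y)"
    for x y z
    using arg by (intro eval_Comp[where ys = "[y, x]"]) auto
  then show ?thesis unfolding pr3_def by blast
qed

lemma pr3_rec:
  assumes "pr3 A" "pr3 B" "pr3 P" "pr3 N"
  shows "pr3 (\<lambda>x y z. rec_nat (A (P x y z) (P x y z) (P x y z)) (\<lambda>i r. B i r (P x y z)) (N x y z))"
  using pr3_comp[OF pr3_rec_aux[OF assms(1,2)] assms(3) assms(4) pr3_zero] .

lemma pr3_add:
  assumes "pr3 A" "pr3 B" shows "pr3 (\<lambda>x y z. A x y z + B x y z)"
proof -
  have "rec_nat a (\<lambda>i r. Suc r) b = a + b" for a b :: nat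
    by (induction b) auto
  then show ?thesis
    using pr3_rec[OF pr3_proj(1) pr3_Suc[OF pr3_proj(2)] assms] by simp
qed

lemma pr3_diff:
  assumes "pr3 A" "pr3 B" shows "pr3 (\<lambda>x y z. A x y z - B x y z)"
proof -
  have "rec_nat 0 (\<lambda>i r. i) b = b - 1" for b :: nat
    by (cases b) auto
  then have pred: "pr3 D \<Longrightarrow> pr3 (\<lambda>x y z. D x y z - 1)" for D
    using pr3_rec[OF pr3_zero pr3_proj(1) pr3_zero, of D] by simp
  have "rec_nat a (\<lambda>i r. r - 1) b = a - b" for a b :: nat
    by (induction b) auto
  then show ?thesis
    using pr3_rec[OF pr3_proj(1) pred[OF pr3_proj(2)] assms] by simp
qed

lemma pr3_triangle:
  assumes "pr3 A" shows "pr3 (\<lambda>x y z. triangle (A x y z))"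
proof -
  have "rec_nat 0 (\<lambda>i r. r + Suc i) b = triangle b" for b :: nat
    by (induction b) auto
  then show ?thesis
    using pr3_rec[OF pr3_zero pr3_add[OF pr3_proj(2) pr3_Suc[OF pr3_proj(1)]] pr3_zero assms]
    by simp
qed

lemma pr3_if0:
  assumes "pr3 A" "pr3 B" "pr3 N"
  shows "pr3 (\<lambda>x y z. if N x y z = 0 then A x y z else B x y z)"
proof -
  have "rec_nat 0 (\<lambda>i r. Suc 0) n = (if n = 0 then 0 else Suc 0)" for n :: nat
    by (cases n) auto
  then have sg: "pr3 (\<lambda>x y z. if D x y z = 0 then 0 else Suc 0)" if "pr3 D" for D
    using pr3_rec[OF pr3_zero pr3_Suc[OF pr3_zero] pr3_zero that] by simp
  have "rec_nat 0 (\<lambda>i r. a) n = (if n = 0 then 0 else a)" for a n :: nat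
    by (cases n) auto
  then have guard: "pr3 (\<lambda>x y z. if D x y z = 0 then 0 else E x y z)" if "pr3 D" "pr3 E" for D E
    using pr3_rec[OF pr3_zero pr3_proj(3) that(2) that(1)] by simp
  \<comment> \<open>The conditional is a sum of two guarded terms, of which at most one differs from
    0.\<close>
  have "pr3 (\<lambda>x y z. (if Suc 0 - (if N x y z = 0 then 0 else Suc 0) = 0 then 0 else A x y z)
               + (if N x y z = 0 then 0 else B x y z))"
    using assms by (intro pr3_add guard pr3_diff sg pr3_Suc pr3_zero)
  moreover have "(\<lambda>x y z. (if Suc 0 - (if N x y z = 0 then 0 else Suc 0) = 0 then 0 else A x y z)
               + (if N x y z = 0 then 0 else B x y z)) =
       (\<lambda>x y z. if N x y z = 0 then A x y z else B x y z)"
    by (intro ext) auto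
  ultimately show ?thesis by simp
qed

section \<open>Pairing and unary primitive recursive functions\<close>

abbreviation pair :: "nat \<Rightarrow> nat \<Rightarrow> nat" where "pair a b \<equiv> prod_encode (a, b)"
abbreviation pfst :: "nat \<Rightarrow> nat" where "pfst n \<equiv> fst (prod_decode n)"
abbreviation psnd :: "nat \<Rightarrow> nat" where "psnd n \<equiv> snd (prod_decode n)"

text \<open>This is the largest \<open>k\<close> with \<open>triangle k \<le> n\<close>, the index
  of the diagonal of the Cantor pairing that contains \<open>n\<close>. It grows by at most 1 per
  step. The truncated subtraction expresses \<open>triangle (Suc k) \<le> Suc n\<close> as a test
  for zero.\<close>

fun diagonal :: "nat \<Rightarrow> nat" where
  "diagonal 0 = 0"
| "diagonal (Suc n) = (if triangle (Suc (diagonal n)) - Suc n = 0 then Suc (diagonal n) else diagonal n)"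

lemma diagonal_bounds: "triangle (diagonal n) \<le> n \<and> n < triangle (Suc (diagonal n))"
  by (induction n) auto

lemma prod_decode_diagonal:
  "prod_decode n = (n - triangle (diagonal n), diagonal n - (n - triangle (diagonal n)))"
proof -
  define k where "k = diagonal n"
  have k: "triangle k \<le> n" "n < triangle (Suc k)"
    unfolding k_def using diagonal_bounds by auto
  have "prod_encode (n - triangle k, k - (n - triangle k)) = n"
    using k by (simp add: prod_encode_def)
  then show ?thesis
    by (metis k_def prod_encode_inverse)
qed

definition prim_rec :: "(nat \<Rightarrow> nat) \<Rightarrow> bool" where
  "prim_rec f \<longleftrightarrow> pr3 (\<lambda>x y z. f x)"

lemma prim_rec_compose:
  assumes "prim_rec f" "prim_rec g" shows "prim_rec (\<lambda>x. f (g x))"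
  using assms pr3_comp unfolding prim_rec_def by blast

lemma pr3_prim_rec:
  assumes "prim_rec f" "pr3 F" shows "pr3 (\<lambda>x y z. f (F x y z))"
  using assms pr3_comp unfolding prim_rec_def by blast

lemma prim_rec_id: "prim_rec (\<lambda>x. x)"
  unfolding prim_rec_def by (rule pr3_proj)

lemma prim_rec_zero: "prim_rec (\<lambda>x. 0)"
  unfolding prim_rec_def by (rule pr3_zero)

lemma prim_rec_Suc: "prim_rec f \<Longrightarrow> prim_rec (\<lambda>x. Suc (f x))"
  unfolding prim_rec_def by (rule pr3_Suc)

lemma prim_rec_const: "prim_rec (\<lambda>x. c)"
  by (induction c) (auto intro: prim_rec_zero prim_rec_Suc)

lemma prim_rec_diff: "prim_rec f \<Longrightarrow> prim_rec g \<Longrightarrow> prim_rec (\<lambda>x. f x - g x)"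
  unfolding prim_rec_def by (rule pr3_diff)

lemma prim_rec_if0:
  "prim_rec n \<Longrightarrow> prim_rec f \<Longrightarrow> prim_rec g \<Longrightarrow> prim_rec (\<lambda>x. if n x = 0 then f x else g x)"
  unfolding prim_rec_def by (rule pr3_if0)

lemma pr3_pair: "pr3 F \<Longrightarrow> pr3 G \<Longrightarrow> pr3 (\<lambda>x y z. pair (F x y z) (G x y z))"
  unfolding prod_encode_def by (simp, intro pr3_add pr3_triangle)

lemma prim_rec_pair: "prim_rec f \<Longrightarrow> prim_rec g \<Longrightarrow> prim_rec (\<lambda>x. pair (f x) (g x))"
  unfolding prim_rec_def by (rule pr3_pair)

lemma prim_rec_diagonal: "prim_rec diagonal"
proof -
  have "rec_nat 0 (\<lambda>i r. if triangle (Suc r) - Suc i = 0 then Suc r else r) n = diagonal n" for n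
    by (induction n) (auto simp del: triangle_Suc)
  moreover have "pr3 (\<lambda>i r _. if triangle (Suc r) - Suc i = 0 then Suc r else r)"
    by (intro pr3_if0 pr3_diff pr3_triangle pr3_Suc pr3_proj)
  ultimately show ?thesis
    using pr3_rec[OF pr3_zero _ pr3_zero pr3_proj(1)] unfolding prim_rec_def by fastforce
qed

lemma prim_rec_pfst': "prim_rec pfst" and prim_rec_psnd': "prim_rec psnd"
  unfolding prod_decode_diagonal fst_conv snd_conv using prim_rec_diagonal unfolding prim_rec_def
  by (intro pr3_diff pr3_triangle pr3_proj | assumption)+

lemma prim_rec_pfst: "prim_rec f \<Longrightarrow> prim_rec (\<lambda>x. pfst (f x))"
  using prim_rec_compose prim_rec_pfst' by blast

lemma prim_rec_psnd: "prim_rec f \<Longrightarrow> prim_rec (\<lambda>x. psnd (f x))"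
  using prim_rec_compose prim_rec_psnd' by blast

lemma prim_rec_rec:
  assumes a: "prim_rec a" and b: "prim_rec (\<lambda>z. b (pfst z) (pfst (psnd z)) (psnd (psnd z)))"
    and n: "prim_rec n"
  shows "prim_rec (\<lambda>x. rec_nat (a x) (\<lambda>i r. b x i r) (n x))"
proof -
  have "pr3 (\<lambda>i r x. b x i r)"
    using pr3_prim_rec[OF b pr3_pair[OF pr3_proj(3) pr3_pair[OF pr3_proj(1) pr3_proj(2)]]] by simp
  moreover have "pr3 (\<lambda>x y z. a x)"
    using a unfolding prim_rec_def .
  ultimately show ?thesis
    using pr3_rec[of "\<lambda>x y z. a x" "\<lambda>i r x. b x i r" "\<lambda>x y z. x" "\<lambda>x y z. n x"] n pr3_proj
    unfolding prim_rec_def by auto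
qed

lemma prim_rec_eval:
  assumes "prim_rec f" shows "\<exists>e. \<forall>x. eval e [x] (f x)"
proof -
  obtain e where e: "\<And>x y z. eval e [x, y, z] (f x)"
    using assms unfolding prim_rec_def pr3_def by blast
  have "eval (Proj 0) [x] x" for x
    using eval_Proj[of 0 "[x]"] by (simp add: getarg_def)
  then have "eval (Comp e [Proj 0, Proj 0, Proj 0]) [x] (f x)" for x
    using e by (intro eval_Comp[where ys = "[x, x, x]"]) auto
  then show ?thesis by blast
qed

lemmas prim_rec_intros =
  prim_rec_const prim_rec_id prim_rec_Suc prim_rec_diff prim_rec_pair prim_rec_pfst prim_rec_psnd
  prim_rec_if0 prim_rec_rec

section \<open>Taking apart codes of lists\<close>

definition ltl :: "nat \<Rightarrow> nat" where "ltl c = psnd (c - 1)"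

lemma ltl_list_encode: "ltl (list_encode xs) = list_encode (tl xs)"
proof (cases xs)
  case Nil
  then show ?thesis by (simp add: ltl_def prod_decode_diagonal)
qed (simp add: ltl_def)

definition ldrop :: "nat \<Rightarrow> nat \<Rightarrow> nat" where "ldrop i c = rec_nat c (\<lambda>_ r. ltl r) i"

lemma ldrop_list_encode: "ldrop i (list_encode xs) = list_encode (drop i xs)"
  by (induction i) (auto simp: ldrop_def ltl_list_encode drop_Suc tl_drop)

lemma prim_rec_ldrop: "prim_rec f \<Longrightarrow> prim_rec g \<Longrightarrow> prim_rec (\<lambda>x. ldrop (f x) (g x))"
  unfolding ldrop_def ltl_def by (intro prim_rec_intros)

lemma list_encode_eq_0_iff: "list_encode xs = 0 \<longleftrightarrow> xs = []"
  by (cases xs) auto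

lemma ldrop_nth: "i < length xs \<Longrightarrow> pfst (ldrop i (list_encode xs) - 1) = xs ! i"
  by (simp add: ldrop_list_encode flip: Cons_nth_drop_Suc)

lemma ldrop_eq_0: "ldrop i (list_encode xs) = 0 \<longleftrightarrow> length xs \<le> i"
  by (simp add: ldrop_list_encode list_encode_eq_0_iff)

section \<open>Functionals that query the oracle finitely often\<close>

abbreviation code_upto :: "baire \<Rightarrow> nat \<Rightarrow> nat" where
  "code_upto p n \<equiv> list_encode (map p [0..<n])"

text \<open>Functionals of an oracle p that query it finitely often: once a long enough prefix of p
  is given, the approximating function returns the successor of the value, and 0 before.\<close>
definition oracle_rec :: "(baire \<Rightarrow> nat \<Rightarrow> nat) \<Rightarrow> bool" where
  "oracle_rec f \<longleftrightarrow> (\<exists>\<phi>. prim_rec \<phi> \<and>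
     (\<forall>p x. \<exists>N. \<forall>n. \<phi> (pair (code_upto p n) x) = (if N \<le> n then Suc (f p x) else 0)))"

lemma oracle_rec_prim_rec:
  assumes "prim_rec f" shows "oracle_rec (\<lambda>p. f)"
  unfolding oracle_rec_def
  by (rule exI[of _ "\<lambda>z. Suc (f (psnd z))"])
     (use prim_rec_Suc[OF prim_rec_compose[OF assms prim_rec_psnd']] in auto)

lemma oracle_rec_query: "oracle_rec (\<lambda>p x. p x)"
proof -
  let ?\<phi> = "\<lambda>z. if ldrop (psnd z) (pfst z) = 0 then 0 else Suc (pfst (ldrop (psnd z) (pfst z) - 1))"
  have "prim_rec ?\<phi>"
    by (intro prim_rec_intros prim_rec_ldrop)
  moreover have "?\<phi> (pair (code_upto p n) x) = (if Suc x \<le> n then Suc (p x) else 0)" for p n x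
    using ldrop_nth[of x "map p [0..<n]"] by (auto simp: ldrop_eq_0)
  ultimately show ?thesis
    unfolding oracle_rec_def by blast
qed

lemma oracle_rec_compose:
  assumes "oracle_rec f" "oracle_rec g" shows "oracle_rec (\<lambda>p x. f p (g p x))"
proof -
  obtain \<phi> where \<phi>: "prim_rec \<phi>"
    "\<And>p x. \<exists>N. \<forall>n. \<phi> (pair (code_upto p n) x) = (if N \<le> n then Suc (f p x) else 0)"
    using assms(1) unfolding oracle_rec_def by blast
  obtain \<psi> where \<psi>: "prim_rec \<psi>"
    "\<And>p x. \<exists>N. \<forall>n. \<psi> (pair (code_upto p n) x) = (if N \<le> n then Suc (g p x) else 0)"
    using assms(2) unfolding oracle_rec_def by blast
  let ?\<chi> = "\<lambda>z. if \<psi> z = 0 then 0 else \<phi> (pair (pfst z) (\<psi> z - 1))"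
  have "prim_rec ?\<chi>"
    by (intro prim_rec_intros \<psi> prim_rec_compose[OF \<phi>(1)])
  moreover have "\<exists>N. \<forall>n. ?\<chi> (pair (code_upto p n) x) = (if N \<le> n then Suc (f p (g p x)) else 0)"
    for p x
  proof -
    obtain M where "\<And>n. \<psi> (pair (code_upto p n) x) = (if M \<le> n then Suc (g p x) else 0)"
      using \<psi>(2) by blast
    moreover obtain N where
      "\<And>n. \<phi> (pair (code_upto p n) (g p x)) = (if N \<le> n then Suc (f p (g p x)) else 0)"
      using \<phi>(2) by blast
    ultimately show ?thesis
      by (intro exI[of _ "max M N"]) auto
  qed
  ultimately show ?thesis
    unfolding oracle_rec_def by blast
qed

lemma oracle_rec_pair:
  assumes "oracle_rec f" "oracle_rec g" shows "oracle_rec (\<lambda>p x. pair (f p x) (g p x))"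
proof -
  obtain \<phi> where \<phi>: "prim_rec \<phi>"
    "\<And>p x. \<exists>N. \<forall>n. \<phi> (pair (code_upto p n) x) = (if N \<le> n then Suc (f p x) else 0)"
    using assms(1) unfolding oracle_rec_def by blast
  obtain \<psi> where \<psi>: "prim_rec \<psi>"
    "\<And>p x. \<exists>N. \<forall>n. \<psi> (pair (code_upto p n) x) = (if N \<le> n then Suc (g p x) else 0)"
    using assms(2) unfolding oracle_rec_def by blast
  let ?\<chi> = "\<lambda>z. if \<phi> z = 0 then 0 else if \<psi> z = 0 then 0 else Suc (pair (\<phi> z - 1) (\<psi> z - 1))"
  have "prim_rec ?\<chi>"
    by (intro prim_rec_intros \<psi> \<phi>)
  moreover have "\<exists>N. \<forall>n. ?\<chi> (pair (code_upto p n) x) =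
      (if N \<le> n then Suc (pair (f p x) (g p x)) else 0)" for p x
  proof -
    obtain M where "\<And>n. \<psi> (pair (code_upto p n) x) = (if M \<le> n then Suc (g p x) else 0)"
      using \<psi>(2) by blast
    moreover obtain N where "\<And>n. \<phi> (pair (code_upto p n) x) = (if N \<le> n then Suc (f p x) else 0)"
      using \<phi>(2) by blast
    ultimately show ?thesis
      by (intro exI[of _ "max M N"]) auto
  qed
  ultimately show ?thesis
    unfolding oracle_rec_def by blast
qed

lemma oracle_rec_rec:
  assumes "oracle_rec a" and "oracle_rec b" and "oracle_rec n"
  shows "oracle_rec (\<lambda>p x. rec_nat (a p x) (\<lambda>i r. b p (pair x (pair i r))) (n p x))"
proof -
  obtain \<alpha> where \<alpha>: "prim_rec \<alpha>"
    "\<And>p x. \<exists>N. \<forall>n. \<alpha> (pair (code_upto p n) x) = (if N \<le> n then Suc (a p x) else 0)"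
    using assms(1) unfolding oracle_rec_def by blast
  obtain \<beta> where \<beta>: "prim_rec \<beta>"
    "\<And>p x. \<exists>N. \<forall>n. \<beta> (pair (code_upto p n) x) = (if N \<le> n then Suc (b p x) else 0)"
    using assms(2) unfolding oracle_rec_def by blast
  define R where "R p x k = rec_nat (a p x) (\<lambda>i r. b p (pair x (pair i r))) k" for p x k
  \<comment> \<open>The intermediate results are shifted by one: 0 means that some query is still
    unanswered, and it is passed on through all later steps.\<close>
  define \<rho> where "\<rho> c x k = rec_nat (\<alpha> (pair c x))
      (\<lambda>i r. if r = 0 then 0 else \<beta> (pair c (pair x (pair i (r - 1))))) k" for c x k
  have "prim_rec (\<lambda>z. \<rho> (pfst z) (pfst (psnd z)) (psnd (psnd z)))"
    unfolding \<rho>_def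
    by (intro prim_rec_intros prim_rec_compose[OF \<alpha>(1)] prim_rec_compose[OF \<beta>(1)])
  moreover have "\<exists>N. \<forall>n. \<rho> (code_upto p n) x k = (if N \<le> n then Suc (R p x k) else 0)" for p x k
  proof (induction k)
    case 0
    then show ?case unfolding \<rho>_def R_def nat.rec by (rule \<alpha>(2))
  next
    case (Suc k)
    then obtain M where "\<And>n. \<rho> (code_upto p n) x k = (if M \<le> n then Suc (R p x k) else 0)"
      by blast
    moreover have "\<rho> c x (Suc k) =
        (if \<rho> c x k = 0 then 0 else \<beta> (pair c (pair x (pair k (\<rho> c x k - 1)))))" for c
      by (simp add: \<rho>_def)
    moreover obtain N where "\<And>n. \<beta> (pair (code_upto p n) (pair x (pair k (R p x k)))) =
        (if N \<le> n then Suc (R p x (Suc k)) else 0)"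
      using \<beta>(2)[of p "pair x (pair k (R p x k))"] unfolding R_def nat.rec by blast
    ultimately show ?case
      by (intro exI[of _ "max M N"]) auto
  qed
  ultimately have "oracle_rec (\<lambda>p z. R p (pfst z) (psnd z))"
    unfolding oracle_rec_def
    by (intro exI[of _ "\<lambda>z. \<rho> (pfst z) (pfst (psnd z)) (psnd (psnd z))"]) auto
  from oracle_rec_compose[OF this oracle_rec_pair[OF oracle_rec_prim_rec[OF prim_rec_id] assms(3)]]
  show ?thesis by (simp add: R_def)
qed

section \<open>Machines from approximations and searches\<close>

text \<open>A machine sees only the code of its input prefix. That code grows with the prefix and is
  at least its length, so it can bound both the amount of output and the range of a search.\<close>

lemma list_encode_prefix_mono: "list_encode xs \<le> list_encode (xs @ ys)"
proof (induction xs)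
  case (Cons x xs)
  have "triangle (x + a) \<le> triangle (x + b)" if "a \<le> b" for a b
    unfolding triangle_def using that by (intro div_le_mono mult_le_mono) auto
  then have "prod_encode (x, a) \<le> prod_encode (x, b)" if "a \<le> b" for a b
    using that by (simp add: prod_encode_def)
  with Cons show ?case by simp
qed simp

lemma length_le_list_encode: "length xs \<le> list_encode xs"
proof (induction xs)
  case (Cons x xs)
  then show ?case using le_prod_encode_2[of "list_encode xs" x] by simp
qed simp

lemma upt_split: "i \<le> j \<Longrightarrow> j \<le> k \<Longrightarrow> [i..<k] = [i..<j] @ [j..<k]"
  using upt_add_eq_append[of i j "k - j"] by simp

lemma code_upto_mono: "m \<le> n \<Longrightarrow> code_upto p m \<le> code_upto p n"
  using list_encode_prefix_mono[of "map p [0..<m]" "map p [m..<n]"]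
  by (simp add: upt_split[of 0 m n])

lemma le_code_upto: "n \<le> code_upto p n"
  using length_le_list_encode[of "map p [0..<n]"] by simp

text \<open>The list is built from the last index down, and a zero discards everything after it.
  What remains is the longest initial run of nonzero values, each lowered by one.\<close>

definition collect :: "(nat \<Rightarrow> nat) \<Rightarrow> nat \<Rightarrow> nat" where
  "collect g L = rec_nat 0 (\<lambda>i r. if g (L - Suc i) = 0 then 0
     else Suc (pair (g (L - Suc i) - 1) r)) L"

lemma collect_eq:
  "collect g L = list_encode (map (\<lambda>k. g k - 1) (takeWhile (\<lambda>k. g k \<noteq> 0) [0..<L]))"
proof -
  have "rec_nat 0 (\<lambda>i r. if g (L - Suc i) = 0 then 0 else Suc (pair (g (L - Suc i) - 1) r)) i =
      list_encode (map (\<lambda>k. g k - 1) (takeWhile (\<lambda>k. g k \<noteq> 0) [L - i..<L]))" if "i \<le> L" for i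
    using that
  proof (induction i)
    case (Suc i)
    then have "[L - Suc i..<L] = (L - Suc i) # [L - i..<L]"
      by (simp add: Suc_diff_Suc upt_rec)
    with Suc show ?case by simp
  qed simp
  from this[of L] show ?thesis by (simp add: collect_def)
qed

text \<open>The machine writes the entries known without a gap, among as many as the code of its
  prefix allows. An entry once known stays known with the same value, so the outputs extend each
  other.\<close>

lemma machine_out_approximation:
  assumes \<phi>: "prim_rec \<phi>"
  obtains e where "\<And>p q. (\<And>k. \<exists>N. \<forall>n. \<phi> (pair (code_upto p n) k) = (if N \<le> n then Suc (q k) else 0))
    \<Longrightarrow> machine_out e p q"
proof -
  let ?F = "\<lambda>c. collect (\<lambda>k. \<phi> (pair c k)) c"
  have "prim_rec ?F"
    unfolding collect_def by (intro prim_rec_intros prim_rec_compose[OF \<phi>])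
  then obtain e where e: "\<And>c. eval e [c] (?F c)"
    using prim_rec_eval by blast
  have "machine_out e p q"
    if "\<And>k. \<exists>N. \<forall>n. \<phi> (pair (code_upto p n) k) = (if N \<le> n then Suc (q k) else 0)" for p q
  proof -
    from that obtain N where
      N: "\<And>k n. \<phi> (pair (code_upto p n) k) = (if N k \<le> n then Suc (q k) else 0)"
      by metis
    define out where "out n = map q (takeWhile (\<lambda>k. N k \<le> n) [0..<code_upto p n])" for n
    have pos: "(\<lambda>k. \<phi> (pair (code_upto p n) k) \<noteq> 0) = (\<lambda>k. N k \<le> n)" for n
      by (simp add: N fun_eq_iff)
    have val: "\<phi> (pair (code_upto p n) k) - 1 = q k"
      if "k \<in> set (takeWhile (\<lambda>k. N k \<le> n) [0..<code_upto p n])" for k n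
      using set_takeWhileD[OF that] by (simp add: N)
    have "?F (code_upto p n) = list_encode (out n)" for n
      unfolding collect_eq out_def pos by (intro arg_cong[of _ _ list_encode] map_cong refl val)
    with e have ev: "eval e [code_upto p n] y \<longleftrightarrow> y = list_encode (out n)" for n y
      using eval_deterministic by metis
    have "prefix (out n) (out (Suc n))" for n
    proof -
      have eq: "[0..<code_upto p (Suc n)] = [0..<code_upto p n] @ [code_upto p n..<code_upto p (Suc n)]"
        using code_upto_mono[of n "Suc n" p] by (intro upt_split) auto
      have takeWhile_mono: "prefix (takeWhile P xs) (takeWhile Q (xs @ ys))"
        if "\<And>x. P x \<Longrightarrow> Q x" for P Q and xs ys :: "nat list"
        using that by (induction xs) auto
      show ?thesis
        unfolding out_def eq by (intro map_mono_prefix takeWhile_mono) simp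
    qed
    moreover have "\<exists>n. k < length (out n) \<and> out n ! k = q k" for k
    proof -
      \<comment> \<open>The sum dominates every threshold up to \<open>k\<close>, and
        \<open>Suc k\<close> makes the bound \<open>code_upto p n\<close> exceed
        \<open>k\<close>.\<close>
      define n where "n = Suc k + (\<Sum>i\<le>k. N i)"
      have "k < code_upto p n"
        using le_code_upto[of n p] by (simp add: n_def)
      then have "[0..<code_upto p n] = [0..<Suc k] @ [Suc k..<code_upto p n]"
        by (intro upt_split) auto
      moreover have "N i \<le> n" if "i \<le> k" for i
        using member_le_sum[of i "{..k}" N] that by (simp add: n_def)
      ultimately have "\<exists>zs. out n = map q [0..<Suc k] @ zs"
        unfolding out_def by (subst \<open>[0..<code_upto p n] = _\<close>, subst takeWhile_append2) auto
      then show ?thesis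
        by (intro exI[of _ n]) (auto simp: nth_append simp del: upt_Suc)
    qed
    ultimately show ?thesis
      unfolding machine_out_def ev by simp
  qed
  then show ?thesis using that by blast
qed

text \<open>Values of \<open>g\<close> are 0 for unknown, 1 for a known failure and more for a known
  success. The state is 0 while only failures were met, 1 once an unknown value blocks the search,
  and \<open>Suc (Suc t)\<close> after success at \<open>t\<close>. Passing over an unknown
  candidate would let the answer change on a longer prefix.\<close>

definition search :: "(nat \<Rightarrow> nat) \<Rightarrow> nat \<Rightarrow> nat" where
  "search g b = rec_nat 0 (\<lambda>i r. if r = 0 then if g i = 0 then 1 else if g i - 1 = 0 then 0
     else Suc (Suc i) else r) b"

lemma search_Suc:
  "search g (Suc b) = (if search g b = 0 then if g b = 0 then 1 else if g b - 1 = 0 then 0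
     else Suc (Suc b) else search g b)"
  by (simp add: search_def)

lemma search_pending: "(\<And>i. i < b \<Longrightarrow> g i = 1) \<Longrightarrow> search g b = 0"
proof (induction b)
  case 0
  then show ?case by (simp add: search_def)
qed (simp add: search_Suc)

lemma search_found: "(\<And>i. i < t \<Longrightarrow> g i = 1) \<Longrightarrow> g t > 1 \<Longrightarrow> t < b \<Longrightarrow> search g b = Suc (Suc t)"
proof (induction b)
  case (Suc b)
  show ?case
  proof (cases "t = b")
    case True
    with Suc.prems search_pending[of b g] show ?thesis by (simp add: search_Suc)
  next
    case False
    with Suc show ?thesis by (simp add: search_Suc)
  qed
qed simp

lemma searchD: "search g b = Suc (Suc t) \<Longrightarrow> t < b \<and> g t > 1 \<and> (\<forall>i<t. g i = 1)"
proof -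
  have "(search g b = 0 \<longrightarrow> (\<forall>i<b. g i = 1)) \<and>
      (\<forall>t. search g b = Suc (Suc t) \<longrightarrow> t < b \<and> g t > 1 \<and> (\<forall>i<t. g i = 1))"
    by (induction b) (auto simp: search_Suc less_Suc_eq search_def split: if_splits)
  then show "search g b = Suc (Suc t) \<Longrightarrow> t < b \<and> g t > 1 \<and> (\<forall>i<t. g i = 1)" by blast
qed

lemma machine_out_search:
  assumes "oracle_rec ok" "oracle_rec val"
  obtains e where "\<And>p. \<exists>t. ok p t \<noteq> 0 \<Longrightarrow>
    machine_out e p (\<lambda>k. val p (pair (LEAST t. ok p t \<noteq> 0) k))"
proof -
  obtain \<phi> where \<phi>: "prim_rec \<phi>"
    "\<And>p x. \<exists>N. \<forall>n. \<phi> (pair (code_upto p n) x) = (if N \<le> n then Suc (ok p x) else 0)"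
    using assms(1) unfolding oracle_rec_def by blast
  obtain \<psi> where \<psi>: "prim_rec \<psi>"
    "\<And>p x. \<exists>N. \<forall>n. \<psi> (pair (code_upto p n) x) = (if N \<le> n then Suc (val p x) else 0)"
    using assms(2) unfolding oracle_rec_def by blast
  let ?s = "\<lambda>c. search (\<lambda>t. \<phi> (pair c t)) c"
  let ?\<chi> = "\<lambda>z. if ?s (pfst z) - 1 = 0 then 0
    else \<psi> (pair (pfst z) (pair (?s (pfst z) - 2) (psnd z)))"
  have "prim_rec ?\<chi>"
    unfolding search_def by (intro prim_rec_intros prim_rec_compose[OF \<phi>(1)] prim_rec_compose[OF \<psi>(1)])
  then obtain e where e: "\<And>p q. (\<And>k. \<exists>N. \<forall>n. ?\<chi> (pair (code_upto p n) k) =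
      (if N \<le> n then Suc (q k) else 0)) \<Longrightarrow> machine_out e p q"
    using machine_out_approximation by blast
  have "machine_out e p (\<lambda>k. val p (pair (LEAST t. ok p t \<noteq> 0) k))" if "\<exists>t. ok p t \<noteq> 0" for p
  proof (rule e)
    fix k
    define t where "t = (LEAST t. ok p t \<noteq> 0)"
    have t: "ok p t \<noteq> 0" "\<And>i. i < t \<Longrightarrow> ok p i = 0"
      using LeastI_ex[OF that] not_less_Least unfolding t_def by auto
    obtain N where N: "\<And>x n. \<phi> (pair (code_upto p n) x) = (if N x \<le> n then Suc (ok p x) else 0)"
      using \<phi>(2)[of p] by metis
    obtain M where M: "\<And>n. \<psi> (pair (code_upto p n) (pair t k)) =
        (if M \<le> n then Suc (val p (pair t k)) else 0)"
      using \<psi>(2) by blast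
    let ?ready = "\<lambda>n. t < code_upto p n \<and> (\<forall>i\<le>t. N i \<le> n)"
    have found: "?s (code_upto p n) - 1 \<noteq> 0 \<longleftrightarrow> ?ready n" for n
    proof
      assume "?s (code_upto p n) - 1 \<noteq> 0"
      then obtain u where "?s (code_upto p n) = Suc (Suc u)"
        by (metis diff_0_eq_0 diff_Suc_1 not0_implies_Suc)
      from searchD[OF this] have u: "u < code_upto p n" "ok p u \<noteq> 0" "N u \<le> n"
        "\<forall>i<u. N i \<le> n \<and> ok p i = 0"
        by (auto simp: N split: if_splits)
      then have "u = t" using t by (metis linorder_neqE_nat)
      with u show "?ready n" by (auto simp: le_less)
    next
      assume "?ready n"
      then show "?s (code_upto p n) - 1 \<noteq> 0"
        using t by (subst search_found[of t]) (auto simp: N)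
    qed
    have val: "?s (code_upto p n) - 2 = t" if "?ready n" for n
      using t that by (subst search_found[of t]) (auto simp: N)
    define K where "K = M + Suc t + (\<Sum>i\<le>t. N i)"
    have "?ready n" if "K \<le> n" for n
    proof -
      have "N i \<le> n" if "i \<le> t" for i
        using member_le_sum[of i "{..t}" N] that \<open>K \<le> n\<close> by (simp add: K_def)
      with that le_code_upto[of n p] show ?thesis by (auto simp: K_def)
    qed
    moreover have "M \<le> K" by (simp add: K_def)
    ultimately have "\<exists>n. ?ready n \<and> M \<le> n" by blast
    \<comment> \<open>The condition is inherited by longer prefixes, so its least instance is a
      threshold of the form that \<open>e\<close> asks for.\<close>
    define L where "L = (LEAST n. ?ready n \<and> M \<le> n)"
    have L: "?ready L \<and> M \<le> L"
      unfolding L_def using \<open>\<exists>n. ?ready n \<and> M \<le> n\<close> by (rule LeastI_ex)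
    have "?ready n \<and> M \<le> n \<longleftrightarrow> L \<le> n" for n
    proof
      assume "L \<le> n"
      with L code_upto_mono[of L n p] show "?ready n \<and> M \<le> n" by (metis order.trans less_le_trans)
    qed (auto simp: L_def intro: Least_le)
    then have "?\<chi> (pair (code_upto p n) k) = (if L \<le> n then Suc (val p (pair t k)) else 0)" for n
      using found[of n] val[of n] M[of n] by auto
    then show "\<exists>N. \<forall>n. ?\<chi> (pair (code_upto p n) k) =
        (if N \<le> n then Suc (val p (pair (LEAST t. ok p t \<noteq> 0) k)) else 0)"
      unfolding t_def by blast
  qed
  then show ?thesis using that by blast
qed

section \<open>Typed computability\<close>

text \<open>Carrying the encoding in the type allows computability to be stated and composed for
  booleans, pairs and lists directly. Injectivity lets equality of values be tested on
  codes.\<close>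

class coded =
  fixes enc :: "'a \<Rightarrow> nat"
  assumes enc_inject: "enc x = enc y \<longleftrightarrow> x = y"

instantiation nat :: coded
begin
definition enc_nat :: "nat \<Rightarrow> nat" where [simp]: "enc_nat n = n"
instance by standard simp
end

instantiation bool :: coded
begin
definition enc_bool :: "bool \<Rightarrow> nat" where [simp]: "enc_bool b = (if b then 1 else 0)"
instance by standard simp
end

instantiation prod :: (coded, coded) coded
begin
definition enc_prod :: "'a \<times> 'b \<Rightarrow> nat" where [simp]: "enc_prod z = pair (enc (fst z)) (enc (snd z))"
instance by standard (auto simp: enc_inject prod_eq_iff)
end

instantiation list :: (coded) coded
begin
definition enc_list :: "'a list \<Rightarrow> nat" where "enc_list xs = list_encode (map enc xs)"
instance
proof
  have "inj (enc :: 'a \<Rightarrow> nat)"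
    by (simp add: inj_def enc_inject)
  then show "enc xs = enc ys \<longleftrightarrow> xs = ys" for xs ys :: "'a list"
    by (simp add: enc_list_def inj_list_encode[THEN inj_eq] inj_map_eq_map)
qed
end

lemma enc_nat_list [simp]: "enc (xs :: nat list) = list_encode xs"
  by (simp add: enc_list_def map_idI)

definition computable :: "(baire \<Rightarrow> 'a::coded \<Rightarrow> 'b::coded) \<Rightarrow> bool" where
  "computable f \<longleftrightarrow> (\<exists>g. oracle_rec g \<and> (\<forall>p x. g p (enc x) = enc (f p x)))"

lemma computableI: "oracle_rec g \<Longrightarrow> (\<And>p x. g p (enc x) = enc (f p x)) \<Longrightarrow> computable f"
  unfolding computable_def by blast

lemma computableE:
  assumes "computable f"
  obtains g where "oracle_rec g" "\<And>p x. g p (enc x) = enc (f p x)"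
  using assms unfolding computable_def by blast

lemma computable_compose:
  assumes "computable f" "computable g" shows "computable (\<lambda>p x. f p (g p x))"
proof -
  obtain f' where "oracle_rec f'" "\<And>p x. f' p (enc x) = enc (f p x)"
    using assms(1) by (rule computableE) blast
  moreover obtain g' where "oracle_rec g'" "\<And>p x. g' p (enc x) = enc (g p x)"
    using assms(2) by (rule computableE) blast
  ultimately show ?thesis
    using oracle_rec_compose by (intro computableI[of "\<lambda>p x. f' p (g' p x)"]) auto
qed

lemma computable_pair:
  assumes "computable f" "computable g" shows "computable (\<lambda>p x. (f p x, g p x))"
proof -
  obtain f' where "oracle_rec f'" "\<And>p x. f' p (enc x) = enc (f p x)"
    using assms(1) by (rule computableE) blast
  moreover obtain g' where "oracle_rec g'" "\<And>p x. g' p (enc x) = enc (g p x)"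
    using assms(2) by (rule computableE) blast
  ultimately show ?thesis
    using oracle_rec_pair by (intro computableI[of "\<lambda>p x. pair (f' p x) (g' p x)"]) auto
qed

text \<open>Binary functions are stated on \<open>fst z\<close> and \<open>snd z\<close>, so that
  bound variables of sums and quantifiers become components of an ordinary argument.\<close>

lemma computable_compose2:
  assumes "computable (\<lambda>p z. h p (fst z) (snd z))" "computable f" "computable g"
  shows "computable (\<lambda>p x. h p (f p x) (g p x))"
  using computable_compose[OF assms(1) computable_pair[OF assms(2,3)]] by simp

lemma computable_id: "computable (\<lambda>p x. x)"
  by (rule computableI[OF oracle_rec_prim_rec[OF prim_rec_id]]) simp

lemma computable_const: "computable (\<lambda>p x. c)"
  by (rule computableI[OF oracle_rec_prim_rec[OF prim_rec_const]]) simp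

lemma computable_query: "computable f \<Longrightarrow> computable (\<lambda>p x. p (f p x))"
  by (rule computable_compose[OF computableI[OF oracle_rec_query]]) simp

lemma computable_fst: "computable f \<Longrightarrow> computable (\<lambda>p x. fst (f p x))"
  by (rule computable_compose[OF computableI[OF oracle_rec_prim_rec[OF prim_rec_pfst']]]) simp

lemma computable_snd: "computable f \<Longrightarrow> computable (\<lambda>p x. snd (f p x))"
  by (rule computable_compose[OF computableI[OF oracle_rec_prim_rec[OF prim_rec_psnd']]]) simp

text \<open>A map between types that leaves the code unchanged is the identity on codes. Encoding
  and decoding of pairs and lists are of this kind.\<close>

lemma computable_recode:
  assumes "computable f" "\<And>x. enc (h x) = enc x" shows "computable (\<lambda>p x. h (f p x))"
  by (rule computable_compose[OF computableI[OF oracle_rec_prim_rec[OF prim_rec_id]]])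
    (simp_all add: assms)

lemma computable_prod_encode: "computable f \<Longrightarrow> computable (\<lambda>p x. prod_encode (f p x))"
  by (rule computable_recode) simp_all

lemma computable_prod_decode: "computable f \<Longrightarrow> computable (\<lambda>p x. prod_decode (f p x))"
  by (rule computable_recode) simp_all

lemma computable_list_encode: "computable f \<Longrightarrow> computable (\<lambda>p x. list_encode (f p x))"
  by (rule computable_recode) simp_all

lemma computable_list_decode: "computable f \<Longrightarrow> computable (\<lambda>p x. list_decode (f p x))"
  by (rule computable_recode) simp_all

lemma computable_Suc: "computable f \<Longrightarrow> computable (\<lambda>p x. Suc (f p x))"
  by (rule computable_compose[OF computableI[OF oracle_rec_prim_rec[OF prim_rec_Suc[OF prim_rec_id]]]])
    simp

lemma computable_diff:
  assumes "computable f" "computable g" shows "computable (\<lambda>p x. f p x - g p x :: nat)"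
  by (rule computable_compose2[OF computableI[OF oracle_rec_prim_rec[OF
    prim_rec_diff[OF prim_rec_pfst' prim_rec_psnd']]] assms]) simp

lemma computable_add:
  assumes "computable f" "computable g" shows "computable (\<lambda>p x. f p x + g p x :: nat)"
proof -
  have "prim_rec (\<lambda>z. pfst z + psnd z)"
    using prim_rec_pfst' prim_rec_psnd' unfolding prim_rec_def by (rule pr3_add)
  then show ?thesis
    by (intro computable_compose2[OF computableI[OF oracle_rec_prim_rec] assms]) auto
qed

lemma computable_rec_nat:
  assumes "computable a" "computable (\<lambda>p z. b p (fst z) (fst (snd z)) (snd (snd z)))" "computable n"
  shows "computable (\<lambda>p x. rec_nat (a p x) (\<lambda>i r. b p x i r) (n p x))"
proof -
  obtain a' where a: "oracle_rec a'" "\<And>p x. a' p (enc x) = enc (a p x)"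
    using assms(1) by (rule computableE) blast
  obtain b' where b: "oracle_rec b'"
    "\<And>p z. b' p (enc z) = enc (b p (fst z) (fst (snd z)) (snd (snd z)))"
    using assms(2) by (rule computableE) blast
  obtain n' where n: "oracle_rec n'" "\<And>p x. n' p (enc x) = enc (n p x)"
    using assms(3) by (rule computableE) blast
  have "rec_nat (a' p (enc x)) (\<lambda>i r. b' p (pair (enc x) (pair i r))) k =
      enc (rec_nat (a p x) (\<lambda>i r. b p x i r) k)" for p x k
  proof (induction k)
    case (Suc k)
    then show ?case using b(2)[of p "(x, k, _)"] by simp
  qed (simp add: a)
  then show ?thesis
    by (intro computableI[OF oracle_rec_rec[OF a(1) b(1) n(1)]]) (simp add: n)
qed

lemma computable_if:
  assumes "computable c" "computable f" "computable g"
  shows "computable (\<lambda>p x. if c p x then f p x else g p x)"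
proof -
  obtain c' where c: "oracle_rec c'" "\<And>p x. c' p (enc x) = enc (c p x)"
    using assms(1) by (rule computableE) blast
  have "computable (\<lambda>p x. (if c p x then 1 else 0) :: nat)"
    by (rule computableI[OF c(1)]) (simp add: c)
  \<comment> \<open>A case distinction is a recursion with at most one step: it starts from
    \<open>g\<close>, and its single step, taken if \<open>c\<close> holds, yields
    \<open>f\<close>.\<close>
  from computable_rec_nat[OF assms(3) _ this, of "\<lambda>p x i r. f p x"]
  have "computable (\<lambda>p x. rec_nat (g p x) (\<lambda>i r. f p x) (if c p x then 1 else 0))"
    using computable_compose[OF assms(2) computable_fst[OF computable_id]] by blast
  then show ?thesis by (simp add: if_distrib cong: if_cong)
qed

lemma computable_eq_0:
  assumes "computable f" shows "computable (\<lambda>p x. f p x = (0::nat))"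
proof -
  have "computable (\<lambda>p x. rec_nat True (\<lambda>i r. False) (f p x))"
    by (intro computable_rec_nat computable_const assms)
  moreover have "rec_nat True (\<lambda>i r. False) n \<longleftrightarrow> n = 0" for n
    by (cases n) auto
  ultimately show ?thesis by simp
qed

lemma computable_le:
  assumes "computable f" "computable g" shows "computable (\<lambda>p x. f p x \<le> (g p x :: nat))"
  using computable_eq_0[OF computable_diff[OF assms]] by simp

lemma computable_less:
  assumes "computable f" "computable g" shows "computable (\<lambda>p x. f p x < (g p x :: nat))"
  using computable_le[OF computable_Suc[OF assms(1)] assms(2)] by (simp add: Suc_le_eq)

lemma computable_not:
  assumes "computable f" shows "computable (\<lambda>p x. \<not> f p x)"
proof -
  have "(if P then False else True) \<longleftrightarrow> \<not> P" for P by simp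
  with computable_if[OF assms computable_const[of False] computable_const[of True]]
  show ?thesis by (simp only:)
qed

lemma computable_conj:
  assumes "computable f" "computable g" shows "computable (\<lambda>p x. f p x \<and> g p x)"
proof -
  have "(if P then Q else False) \<longleftrightarrow> P \<and> Q" for P Q by simp
  with computable_if[OF assms computable_const[of False]] show ?thesis by (simp only:)
qed

lemma computable_disj:
  assumes "computable f" "computable g" shows "computable (\<lambda>p x. f p x \<or> g p x)"
proof -
  have "(if P then True else Q) \<longleftrightarrow> P \<or> Q" for P Q by simp
  with computable_if[OF assms(1) computable_const[of True] assms(2)] show ?thesis by (simp only:)
qed

lemma computable_imp:
  assumes "computable f" "computable g" shows "computable (\<lambda>p x. f p x \<longrightarrow> g p x)"
  unfolding imp_conv_disj by (intro computable_disj computable_not assms)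

lemma computable_eq:
  assumes "computable f" "computable g" shows "computable (\<lambda>p x. f p x = g p x)"
proof -
  have code: "computable (\<lambda>p x. enc (f p x))" if "computable f"
    for f :: "baire \<Rightarrow> 'a \<Rightarrow> 'b"
    using that by (rule computableE) (auto intro: computableI)
  have "computable (\<lambda>p x. enc (f p x) \<le> enc (g p x) \<and> enc (g p x) \<le> enc (f p x))"
    by (intro computable_conj computable_le code assms)
  then show ?thesis
    by (simp add: enc_inject flip: eq_iff)
qed

lemma computable_all_less:
  fixes n :: "baire \<Rightarrow> 'a::coded \<Rightarrow> nat"
  assumes "computable n" "computable (\<lambda>p z. P p (fst z) (snd z))"
  shows "computable (\<lambda>p x. \<forall>i<n p x. P p x i)"
proof -
  have "computable (\<lambda>p x. rec_nat True (\<lambda>i r. r \<and> P p x i) (n p x))"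
    by (intro computable_rec_nat computable_const computable_conj assms computable_snd
        computable_id computable_compose2[OF assms(2)] computable_fst)
  moreover have "rec_nat True (\<lambda>i r. r \<and> P p x i) k \<longleftrightarrow> (\<forall>i<k. P p x i)" for p x k
    by (induction k) (auto simp: less_Suc_eq)
  ultimately show ?thesis by simp
qed

lemma computable_ex_less:
  fixes n :: "baire \<Rightarrow> 'a::coded \<Rightarrow> nat"
  assumes "computable n" "computable (\<lambda>p z. P p (fst z) (snd z))"
  shows "computable (\<lambda>p x. \<exists>i<n p x. P p x i)"
  using computable_not[OF computable_all_less[OF assms(1) computable_not[OF assms(2)]]]
  by (simp add: not_all)

lemma computable_all_le:
  fixes n :: "baire \<Rightarrow> 'a::coded \<Rightarrow> nat"
  assumes "computable n" "computable (\<lambda>p z. P p (fst z) (snd z))"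
  shows "computable (\<lambda>p x. \<forall>i\<le>n p x. P p x i)"
  using computable_all_less[OF computable_Suc[OF assms(1)] assms(2)] by (simp add: less_Suc_eq_le)

lemma computable_ex_le:
  fixes n :: "baire \<Rightarrow> 'a::coded \<Rightarrow> nat"
  assumes "computable n" "computable (\<lambda>p z. P p (fst z) (snd z))"
  shows "computable (\<lambda>p x. \<exists>i\<le>n p x. P p x i)"
  using computable_ex_less[OF computable_Suc[OF assms(1)] assms(2)] by (simp add: less_Suc_eq_le)

lemma computable_sum:
  fixes n :: "baire \<Rightarrow> 'a::coded \<Rightarrow> nat"
  assumes "computable n" "computable (\<lambda>p z. f p (fst z) (snd z))"
  shows "computable (\<lambda>p x. \<Sum>i<n p x. f p x i :: nat)"
proof -
  have "computable (\<lambda>p x. rec_nat 0 (\<lambda>i r. r + f p x i) (n p x))"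
    by (intro computable_rec_nat computable_const computable_add assms computable_snd
        computable_id computable_compose2[OF assms(2)] computable_fst)
  moreover have "rec_nat 0 (\<lambda>i r. r + f p x i) k = (\<Sum>i<k. f p x i)" for p x k
    by (induction k) auto
  ultimately show ?thesis by simp
qed

lemma computable_mult:
  assumes "computable f" "computable g" shows "computable (\<lambda>p x. f p x * g p x :: nat)"
proof -
  have "computable (\<lambda>p x. \<Sum>i<f p x. g p x)"
    by (intro computable_sum assms computable_compose[OF assms(2)] computable_fst computable_id)
  then show ?thesis by simp
qed

lemma computable_power2:
  assumes "computable f" shows "computable (\<lambda>p x. 2 ^ f p x :: nat)"
proof -
  have "computable (\<lambda>p x. rec_nat 1 (\<lambda>i r. r + r) (f p x) :: nat)"
    by (intro computable_rec_nat computable_const computable_add assms computable_snd computable_id)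
  moreover have "rec_nat 1 (\<lambda>i r. r + r) k = (2 ^ k :: nat)" for k
    by (induction k) auto
  ultimately show ?thesis by simp
qed

lemma computable_even:
  assumes "computable f" shows "computable (\<lambda>p x. even (f p x :: nat))"
proof -
  have "computable (\<lambda>p x. rec_nat True (\<lambda>i r. \<not> r) (f p x))"
    by (intro computable_rec_nat computable_const computable_not assms computable_snd computable_id)
  moreover have "rec_nat True (\<lambda>i r. \<not> r) k = even k" for k
    by (induction k) auto
  ultimately show ?thesis by simp
qed

lemma computable_div2:
  assumes "computable f" shows "computable (\<lambda>p x. f p x div 2 :: nat)"
proof -
  have "computable (\<lambda>p x. rec_nat 0 (\<lambda>i r. if even i then r else Suc r) (f p x) :: nat)"
    by (intro computable_rec_nat computable_const computable_if computable_even computable_Suc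
        assms computable_fst computable_snd computable_id)
  moreover have "rec_nat 0 (\<lambda>i r. if even i then r else Suc r) k = k div 2" for k
    by (induction k) auto
  ultimately show ?thesis by simp
qed

lemma computable_Cons:
  assumes "computable f" "computable g" shows "computable (\<lambda>p x. f p x # g p x)"
proof -
  have "computable (\<lambda>p z. fst z # snd z)"
    using computable_Suc[OF computable_id[where 'a = nat]]
    by (rule computableE) (auto intro!: computableI simp: enc_list_def)
  from computable_compose2[OF this assms] show ?thesis .
qed

lemma computable_drop:
  assumes "computable n" "computable f" shows "computable (\<lambda>p x. drop (n p x) (f p x :: nat list))"
proof -
  have "prim_rec ltl"
    unfolding ltl_def by (intro prim_rec_intros)
  then have tl: "computable (\<lambda>p x. tl (g p x) :: nat list)" if "computable g"
    for g :: "baire \<Rightarrow> 'c::coded \<Rightarrow> nat list"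
    by (intro computable_compose[OF computableI[OF oracle_rec_prim_rec] that])
      (auto simp: ltl_list_encode)
  have "computable (\<lambda>p x. rec_nat (f p x) (\<lambda>i r. tl r) (n p x))"
    by (intro computable_rec_nat tl assms computable_snd computable_id)
  moreover have "rec_nat xs (\<lambda>i r. tl r) k = drop k xs" for xs :: "nat list" and k
    by (induction k) (auto simp: drop_Suc tl_drop)
  ultimately show ?thesis by simp
qed

lemma computable_length:
  assumes "computable f" shows "computable (\<lambda>p x. length (f p x :: nat list))"
proof -
  have f: "computable (\<lambda>p z. f p (fst z))"
    using computable_compose[OF assms computable_fst[OF computable_id]] .
  \<comment> \<open>The length counts the \<open>i\<close> for which something is left after
    dropping \<open>i\<close> entries; the code of the list bounds the range, by
    \<open>length_le_list_encode\<close>.\<close>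
  have "computable (\<lambda>p x. \<Sum>i<list_encode (f p x). if drop i (f p x) = [] then 0 else 1 :: nat)"
    by (intro computable_sum computable_if computable_eq computable_drop computable_const
        computable_list_encode assms f computable_snd computable_id)
  moreover have "(\<Sum>i<k. if length xs \<le> i then 0 else 1) = min k (length xs)" for k and xs :: "nat list"
    by (induction k) (auto simp: min_def)
  ultimately show ?thesis
    using length_le_list_encode by (simp add: min_absorb2)
qed

lemma computable_getarg:
  assumes "computable n" "computable f" shows "computable (\<lambda>p x. getarg (n p x) (f p x))"
proof -
  let ?g = "\<lambda>p x. list_encode (drop (n p x) (f p x))"
  have "computable (\<lambda>p x. if ?g p x = 0 then 0 else fst (prod_decode (?g p x - 1)))"
    by (intro computable_if computable_eq computable_fst computable_prod_decode computable_diff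
        computable_list_encode computable_drop assms computable_const)
  moreover have "(if ?g p x = 0 then 0 else fst (prod_decode (?g p x - 1))) = getarg (n p x) (f p x)"
    for p x
    using ldrop_nth[of "n p x" "f p x"] by (simp add: list_encode_eq_0_iff getarg_def ldrop_list_encode)
  ultimately show ?thesis by (simp only:)
qed

lemma computable_tabulate:
  fixes n :: "baire \<Rightarrow> 'a::coded \<Rightarrow> nat"
  assumes "computable n" "computable (\<lambda>p z. f p (fst z) (snd z))"
  shows "computable (\<lambda>p x. map (\<lambda>i. f p x i) [0..<n p x])"
proof -
  have "rec_nat [] (\<lambda>i r. g (m - Suc i) # r) i = map g [m - i..<m]" if "i \<le> m"
    for g :: "nat \<Rightarrow> 'c" and m i
    using that by (induction i) (simp_all add: Suc_diff_Suc upt_rec)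
  note unfold = this[OF order.refl, unfolded diff_self_eq_0, symmetric]
  have "computable (\<lambda>p x. rec_nat [] (\<lambda>i r. f p x (n p x - Suc i) # r) (n p x))"
    by (intro computable_rec_nat computable_const computable_Cons computable_compose2[OF assms(2)]
      computable_compose[OF assms(1)] computable_diff computable_Suc computable_fst computable_snd
      computable_id assms(1))
  then show ?thesis unfolding unfold .
qed

lemma computable_take:
  assumes "computable n" "computable f" shows "computable (\<lambda>p x. take (n p x) (f p x) :: nat list)"
proof -
  have "take k xs = map (\<lambda>i. getarg i xs) [0..<(if length xs \<le> k then length xs else k)]"
    for k and xs :: "nat list"
    by (rule nth_equalityI) (auto simp: getarg_def)
  moreover have "computable (\<lambda>p x. map (\<lambda>i. getarg i (f p x))
      [0..<(if length (f p x) \<le> n p x then length (f p x) else n p x)])"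
    by (intro computable_tabulate computable_if computable_le computable_length computable_getarg
        computable_compose[OF assms(2)] computable_fst computable_snd computable_id assms)
  ultimately show ?thesis by simp
qed

lemma computable_append:
  assumes "computable f" "computable g" shows "computable (\<lambda>p x. f p x @ g p x :: nat list)"
proof -
  have "xs @ ys = map (\<lambda>i. if i < length xs then getarg i xs else getarg (i - length xs) ys)
      [0..<length xs + length ys]" for xs ys :: "nat list"
    by (rule nth_equalityI) (auto simp: getarg_def nth_append)
  moreover have "computable (\<lambda>p x. map (\<lambda>i. if i < length (f p x) then getarg i (f p x)
      else getarg (i - length (f p x)) (g p x)) [0..<length (f p x) + length (g p x)])"
    by (intro computable_tabulate computable_if computable_less computable_add computable_diff
        computable_length computable_getarg computable_compose[OF assms(1)]
        computable_compose[OF assms(2)] computable_fst computable_snd computable_id assms)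
  ultimately show ?thesis by simp
qed

lemma computable_mem_set:
  assumes "computable f" "computable g" shows "computable (\<lambda>p x. f p x \<in> set (g p x :: nat list))"
proof -
  have "a \<in> set xs \<longleftrightarrow> (\<exists>i<length xs. getarg i xs = a)" for a and xs :: "nat list"
    by (auto simp: in_set_conv_nth getarg_def)
  moreover have "computable (\<lambda>p x. \<exists>i<length (g p x). getarg i (g p x) = f p x)"
    by (intro computable_ex_less computable_length computable_eq computable_getarg
        computable_compose[OF assms(1)] computable_compose[OF assms(2)] computable_fst
        computable_snd computable_id assms)
  ultimately show ?thesis by simp
qed

lemma computable_all_set:
  assumes "computable f" "computable (\<lambda>p z. P p (fst z) (snd z))"
  shows "computable (\<lambda>p x. \<forall>c\<in>set (f p x :: nat list). P p x c)"
proof -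
  have "(\<forall>c\<in>set xs. Q c) \<longleftrightarrow> (\<forall>i<length xs. Q (getarg i xs))" for Q and xs :: "nat list"
    by (simp add: all_set_conv_all_nth getarg_def)
  moreover have "computable (\<lambda>p x. \<forall>i<length (f p x). P p x (getarg i (f p x)))"
    by (intro computable_all_less computable_length computable_compose2[OF assms(2)] computable_getarg
        computable_compose[OF assms(1)] computable_fst computable_snd computable_id assms(1))
  ultimately show ?thesis by simp
qed

lemma bword_iff: "bword w \<longleftrightarrow> (\<forall>c\<in>set w. c \<le> 1)"
  unfolding bword_def by force

lemmas computable_intros =
  computable_id computable_const computable_pair computable_fst computable_snd
  computable_prod_encode computable_prod_decode computable_list_encode computable_list_decode
  computable_Suc computable_diff computable_add computable_mult computable_power2 computable_div2
  computable_even computable_le computable_less computable_not computable_conj computable_disj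
  computable_imp computable_eq computable_if computable_all_less computable_ex_less computable_all_le
  computable_ex_le computable_sum computable_Cons computable_drop computable_length computable_getarg
  computable_tabulate computable_take computable_append computable_mem_set computable_all_set
  computable_query

lemma computable_bword: "computable f \<Longrightarrow> computable (\<lambda>p x. bword (f p x))"
  unfolding bword_iff by (intro computable_intros)

text \<open>This is the shape of both outer machines: \<open>t\<close> codes all the finite data
  that must be known before writing, and \<open>val p t\<close> is the output computed from
  them.\<close>

lemma machine_search_out:
  fixes ok :: "baire \<Rightarrow> nat \<Rightarrow> bool"
  assumes "computable ok" "computable (\<lambda>p z. val p (fst z) (snd z))"
  shows "\<exists>e. \<forall>p. (\<exists>t. ok p t) \<longrightarrow> machine_out e p (val p (LEAST t. ok p t))"
proof -
  obtain ok' where ok: "oracle_rec ok'" "\<And>p t. ok' p t = enc (ok p t)"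
    using assms(1) by (rule computableE) auto
  obtain val' where val: "oracle_rec val'" "\<And>p t k. val' p (pair t k) = val p t k"
    using assms(2) by (rule computableE) (metis enc_nat_def enc_prod_def fst_conv snd_conv)
  obtain e where "\<And>p. \<exists>t. ok' p t \<noteq> 0 \<Longrightarrow>
      machine_out e p (\<lambda>k. val' p (pair (LEAST t. ok' p t \<noteq> 0) k))"
    using machine_out_search[OF ok(1) val(1)] by blast
  moreover have "ok' p t \<noteq> 0 \<longleftrightarrow> ok p t" for p t
    by (simp add: ok)
  ultimately show ?thesis
    by (auto simp: val)
qed

lemma machine_total_out:
  assumes "computable h" shows "\<exists>e. \<forall>p. machine_out e p (h p)"
proof -
  have "computable (\<lambda>p z. h p (snd z))"
    by (intro computable_compose[OF assms] computable_intros)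
  from machine_search_out[OF computable_const[of True] this] show ?thesis by simp
qed

section \<open>Plays and the star of LPO\<close>

lemma play_prefix_eq: "play_prefix s n = map (play s) [0..<n]"
  by (induction n) (auto simp: play_def)

lemma play_unfold: "play s n = s (map (play s) [0..<n])"
  using play_prefix_eq[of s n] by (simp add: play_def)

lemma bword_prefix: "cantor x \<Longrightarrow> bword (map x [0..<n])"
  by (auto simp: cantor_def bword_iff)

lemma cantor_play:
  assumes "strategy s" shows "cantor (play s)"
proof -
  have "play s n \<le> 1" for n
  proof (induction n rule: less_induct)
    case (less n)
    then have "bword (map (play s) [0..<n])"
      by (auto simp: bword_iff)
    then show ?case
      using assms play_unfold[of s n] by (simp add: strategy_def)
  qed
  then show ?thesis by (simp add: cantor_def)
qed

lemma play_bword: "strategy s \<Longrightarrow> bword (map (play s) [0..<n])"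
  by (rule bword_prefix[OF cantor_play])

lemma extends_append:
  "extends x (u @ w) \<longleftrightarrow> extends x u \<and> extends (\<lambda>n. x (length u + n)) w" (is "?L \<longleftrightarrow> ?R")
proof
  assume L: ?L
  have "x i = u ! i" if "i < length u" for i
    using L that unfolding extends_def by (metis length_append nth_append trans_less_add1)
  moreover have "x (length u + i) = w ! i" if "i < length w" for i
    using L that unfolding extends_def by (metis length_append nat_add_left_cancel_less nth_append_length_plus)
  ultimately show ?R by (simp add: extends_def)
next
  assume R: ?R
  have "x i = (u @ w) ! i" if "i < length u + length w" for i
    using R that unfolding extends_def nth_append
    by (metis add_diff_inverse_nat nat_add_left_cancel_less)
  then show ?L by (simp add: extends_def)
qed

text \<open>Unfolding the nested pairs, slot i n is the position of entry n of the i-th component.\<close>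
definition slot :: "nat \<Rightarrow> nat \<Rightarrow> nat" where "slot i n = 2 ^ i * (2 * n + 1) - 1"

lemma Suc_slot: "Suc (slot i n) = 2 ^ i * (2 * n + 1)"
  unfolding slot_def by simp

lemma slot_parity: "even ((2::nat) ^ i * (2 * n + 1)) \<longleftrightarrow> i \<noteq> 0"
  by simp

text \<open>\<open>i\<close> is the exponent of 2 in the number: parity tells whether it is zero,
  and otherwise a factor 2 cancels on both sides.\<close>

lemma slot_aux: "(2::nat) ^ i * (2 * n + 1) = 2 ^ j * (2 * k + 1) \<Longrightarrow> i = j"
proof (induction i arbitrary: j)
  case 0
  then have "even ((2::nat) ^ j * (2 * k + 1)) \<longleftrightarrow> even ((2::nat) ^ 0 * (2 * n + 1))" by (simp only:)
  then show ?case unfolding slot_parity by simp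
next
  case (Suc i)
  then have "even ((2::nat) ^ j * (2 * k + 1)) \<longleftrightarrow> even ((2::nat) ^ Suc i * (2 * n + 1))" by (simp only:)
  then have "j \<noteq> 0" unfolding slot_parity by simp
  then obtain j' where j: "j = Suc j'" by (cases j) auto
  from Suc.prems have "2 ^ i * (2 * n + 1) = 2 ^ j' * (2 * k + 1)"
    unfolding j power_Suc mult.assoc by linarith
  from Suc.IH[OF this] show ?case by (simp only: j)
qed

lemma slot_inject: "slot i n = slot j k \<longleftrightarrow> i = j \<and> n = k"
proof
  assume "slot i n = slot j k"
  then have *: "2 ^ i * (2 * n + 1) = 2 ^ j * (2 * k + 1)"
    unfolding Suc_slot[symmetric] by simp
  then have "i = j" by (rule slot_aux)
  with * have "(2::nat) ^ i * (2 * n + 1) = 2 ^ i * (2 * k + 1)" by (simp only:)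
  then have "2 * n + 1 = 2 * k + 1" unfolding mult_cancel1 by auto
  with \<open>i = j\<close> show "i = j \<and> n = k" by auto
qed simp

text \<open>These bounds turn the inversion of \<open>slot\<close> into a bounded search.\<close>

lemma le_slot: "i \<le> slot i n" "n \<le> slot i n"
proof -
  have "i < 2 ^ i" by (rule less_exp)
  then obtain c where c: "2 ^ i = Suc c" "i \<le> c"
    by (cases "2 ^ i :: nat") auto
  then have "Suc (slot i n) = 2 * n + 1 + c * (2 * n) + c"
    by (simp add: Suc_slot)
  with c(2) show "i \<le> slot i n" "n \<le> slot i n" by linarith+
qed

lemma computable_slot:
  "computable f \<Longrightarrow> computable g \<Longrightarrow> computable (\<lambda>p x. slot (f p x) (g p x))"
  unfolding slot_def by (intro computable_intros)

text \<open>Passing to \<open>bsnd\<close> sends position \<open>k\<close> to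
  \<open>2 * k + 1\<close>, which doubles its successor; this is the origin of the powers of two in
  \<open>slot\<close>.\<close>

lemma slot_bsnd: "bsnd P (slot i n) = P (slot (Suc i) n)"
  using Suc_slot[of i n] Suc_slot[of "Suc i" n] unfolding bsnd_def
  by (intro arg_cong[of _ _ P]) simp

lemma ppow_iff: "ppow f m P Q \<longleftrightarrow> (\<forall>i<m. f (\<lambda>n. P (slot i n)) (\<lambda>n. Q (slot i n)))"
proof (induction m arbitrary: P Q)
  case (Suc m)
  have "bfst P = (\<lambda>n. P (slot 0 n))" for P
    by (simp add: bfst_def slot_def)
  then show ?case
    by (simp add: pprod_def Suc.IH slot_bsnd All_less_Suc2)
qed simp

text \<open>Only the instance stores the exponent, at position 0; hence the shift by
  \<open>Suc\<close> in \<open>P\<close> and none in \<open>Q\<close>.\<close>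

lemma pstar_LPO_iff:
  "pstar LPO P Q \<longleftrightarrow> (\<forall>i<P 0. cantor (\<lambda>n. P (Suc (slot i n))) \<and>
     Q (slot i 0) = (if \<forall>n. P (Suc (slot i n)) = 0 then 1 else 0))"
  by (simp add: pstar_def ppow_iff LPO_def fun_eq_iff)

lemma bfst_bpair [simp]: "bfst (bpair p q) = p" and bsnd_bpair [simp]: "bsnd (bpair p q) = q"
  by (auto simp: bfst_def bsnd_def bpair_def)

lemma computable_bfst: "computable bfst"
  unfolding bfst_def by (intro computable_intros)

lemma computable_bsnd: "computable bsnd"
  unfolding bsnd_def by (intro computable_intros)

section \<open>Reading closed choice and LPO off an equilibrium\<close>

definition lseq :: "baire \<Rightarrow> nat \<Rightarrow> baire" where "lseq p i n = bsnd p (Suc (slot i n))"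
definition lnum :: "baire \<Rightarrow> nat" where "lnum p = bsnd p 0"

definition seen :: "baire \<Rightarrow> nat \<Rightarrow> nat" where
  "seen p t = (\<Sum>i<lnum p. if \<exists>n<t. lseq p i n \<noteq> 0 then 1 else 0)"

definition total :: "baire \<Rightarrow> nat" where
  "total p = card {i. i < lnum p \<and> (\<exists>n. lseq p i n \<noteq> 0)}"

lemma seen_eq_card: "seen p t = card {i. i < lnum p \<and> (\<exists>n<t. lseq p i n \<noteq> 0)}"
  unfolding seen_def by (simp add: sum.If_cases lessThan_def Collect_conj_eq)

lemma seen_le_total: "seen p t \<le> total p"
  unfolding seen_eq_card total_def by (rule card_mono) auto

lemma total_le: "total p \<le> lnum p"
proof -
  have "total p \<le> card {..<lnum p}"
    unfolding total_def by (rule card_mono) auto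
  then show ?thesis by simp
qed

text \<open>The two sets are finite and nested, so equal cardinality makes them equal. Thus the bare
  number of nonzero sequences certifies that each sequence still zero at stage \<open>t\<close> is
  zero forever.\<close>

lemma seen_eq_total:
  assumes "seen p t = total p" "i < lnum p"
  shows "(\<exists>n<t. lseq p i n \<noteq> 0) \<longleftrightarrow> (\<exists>n. lseq p i n \<noteq> 0)"
proof -
  have "{i. i < lnum p \<and> (\<exists>n<t. lseq p i n \<noteq> 0)} = {i. i < lnum p \<and> (\<exists>n. lseq p i n \<noteq> 0)}"
    using assms(1) unfolding seen_eq_card total_def by (intro card_subset_eq) auto
  with assms(2) show ?thesis by blast
qed

lemma ex_seen_total: "\<exists>t. seen p t = total p"
proof -
  define f where "f i = (LEAST n. lseq p i n \<noteq> 0)" for i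
  define t where "t = Suc (\<Sum>i<lnum p. f i)"
  have "f i < t" if "i < lnum p" for i
    using member_le_sum[of i "{..<lnum p}" f] that by (simp add: t_def)
  moreover have "lseq p i (f i) \<noteq> 0" if "lseq p i n \<noteq> 0" for i n
    unfolding f_def using that by (rule LeastI)
  ultimately have "{i. i < lnum p \<and> (\<exists>n<t. lseq p i n \<noteq> 0)} = {i. i < lnum p \<and> (\<exists>n. lseq p i n \<noteq> 0)}"
    by blast
  then have "seen p t = total p"
    unfolding seen_eq_card total_def by (rule arg_cong)
  then show ?thesis ..
qed

text \<open>In the game built from p, player 1 opens with a word 1^j 0, claiming that at least j of the
  sequences are not zero, and player 2 then plays a point that should lie in the closed set.\<close>
definition claim_val :: "baire \<Rightarrow> baire \<Rightarrow> nat" where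
  "claim_val p x = (if \<forall>n. x n \<noteq> 0 then 0 else
     let j = LEAST n. x n = 0 in
     if (\<lambda>n. x (Suc j + n)) \<notin> cls (bfst p) then lnum p + 2
     else if j \<le> total p then Suc j else 0)"

lemma claim_val_eq:
  assumes "\<And>i. i < j \<Longrightarrow> x i \<noteq> 0" "x j = 0"
  shows "claim_val p x = (if (\<lambda>n. x (Suc j + n)) \<notin> cls (bfst p) then lnum p + 2
    else if j \<le> total p then Suc j else 0)"
proof -
  have least: "(LEAST n. x n = 0) = j"
    using assms by (intro Least_equality) (metis, metis not_le)
  have "(\<forall>n. x n \<noteq> 0) \<longleftrightarrow> False"
    using assms(2) by blast
  then show ?thesis
    unfolding claim_val_def Let_def least by (simp only: if_False)
qed

lemma claim_val_cases:
  obtains "\<And>n. x n \<noteq> 0" "claim_val p x = 0"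
  | j where "\<And>i. i < j \<Longrightarrow> x i \<noteq> 0" "x j = 0"
proof (cases "\<forall>n. x n \<noteq> 0")
  case False
  then obtain n where n: "x n = 0" by auto
  show ?thesis
    using that(2)[of "LEAST n. x n = 0"] not_less_Least[of _ "\<lambda>n. x n = 0"] LeastI[of "\<lambda>n. x n = 0", OF n]
    by blast
qed (use that(1) in \<open>auto simp: claim_val_def\<close>)

lemma claim_val_le: "claim_val p x \<le> lnum p + 2"
proof (cases rule: claim_val_cases[where x = x and p = p])
  case (2 j)
  then show ?thesis
    using total_le[of p] claim_val_eq[of j x p] by auto
qed simp

text \<open>An index codes \<open>j\<close>, \<open>t\<close> and a flag. With flag 0 it lists the
  words \<open>1^j 0 w\<close> for \<open>w\<close> the word that entry \<open>t\<close> removes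
  from the closed set; otherwise it lists \<open>1^j 0\<close> if stage \<open>t\<close> supports
  the claim and \<open>i \<le> Suc j\<close>. For \<open>i = 0\<close> the entry 1 stands for the
  empty word, whose cylinder is the whole space.\<close>

definition claim_opn :: "baire \<Rightarrow> nat \<Rightarrow> baire" where
  "claim_opn p i n =
     (if i = 0 then 1
      else if i > lnum p + 2 then 0
      else if snd (prod_decode (snd (prod_decode n))) = 0 then
        (if bfst p (fst (prod_decode (snd (prod_decode n)))) = 0 then 0
         else Suc (list_encode (map (\<lambda>_. 1) [0..<fst (prod_decode n)] @
           0 # list_decode (bfst p (fst (prod_decode (snd (prod_decode n)))) - 1))))
      else if i \<le> Suc (fst (prod_decode n)) \<and> fst (prod_decode n) \<le> seen p (fst (prod_decode (snd (prod_decode n))))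
        then Suc (list_encode (map (\<lambda>_. 1) [0..<fst (prod_decode n)] @ [0]))
      else 0)"

lemma extends_claim:
  "extends x (map (\<lambda>_. 1) [0..<j] @ 0 # w) \<longleftrightarrow>
     (\<forall>i<j. x i = 1) \<and> x j = 0 \<and> extends (\<lambda>n. x (Suc j + n)) w"
proof -
  have "extends y (0 # w) \<longleftrightarrow> y 0 = 0 \<and> extends (\<lambda>n. y (Suc n)) w" for y
    by (auto simp: extends_def All_less_Suc2)
  then show ?thesis
    by (simp add: extends_append) (simp add: extends_def)
qed

lemma cantor_shift: "cantor x \<Longrightarrow> cantor (\<lambda>n. x (k + n))"
  by (simp add: cantor_def)

lemma opn_claim_opn: "opn (claim_opn p i) = {x. cantor x \<and> i \<le> claim_val p x}"
proof (cases "i = 0 \<or> i > lnum p + 2")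
  case True
  then show ?thesis
    using claim_val_le[of p] by (auto simp: opn_def claim_opn_def extends_def dest: leD order.trans)
next
  case False
  show ?thesis
  proof (intro set_eqI iffI)
    fix x assume "x \<in> opn (claim_opn p i)"
    then obtain n c where x: "cantor x" and n: "claim_opn p i n = Suc c" "extends x (list_decode c)"
      unfolding opn_def by blast
    define j t where "j = fst (prod_decode n)" and "t = fst (prod_decode (snd (prod_decode n)))"
    from n False consider
      (out) w where "bfst p t = Suc (list_encode w)" "extends x (map (\<lambda>_. 1) [0..<j] @ 0 # w)"
      | (claim) "i \<le> Suc j" "j \<le> seen p t" "extends x (map (\<lambda>_. 1) [0..<j] @ [0])"
      unfolding claim_opn_def j_def[symmetric] t_def[symmetric]
      by (auto split: if_splits) (metis Suc_pred list_decode_inverse)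
    then show "x \<in> {x. cantor x \<and> i \<le> claim_val p x}"
    proof cases
      case out
      then have j: "\<And>i. i < j \<Longrightarrow> x i \<noteq> 0" "x j = 0" and w: "extends (\<lambda>n. x (Suc j + n)) w"
        unfolding extends_claim by auto
      have "(\<lambda>n. x (Suc j + n)) \<in> opn (bfst p)"
        using w out(1) cantor_shift[OF x, of "Suc j"] unfolding opn_def by force
      then show ?thesis
        using False x claim_val_eq[where x = x and j = j and p = p, OF j] by (simp add: cls_def)
    next
      case claim
      then have j: "\<And>i. i < j \<Longrightarrow> x i \<noteq> 0" "x j = 0"
        unfolding extends_claim by auto
      show ?thesis
        using False x claim claim_val_eq[where x = x and j = j and p = p, OF j] seen_le_total[of p t] by simp
    qed
  next
    fix x assume "x \<in> {x. cantor x \<and> i \<le> claim_val p x}"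
    then have x: "cantor x" and i: "i \<le> claim_val p x" by auto
    with False obtain j where j: "\<And>i. i < j \<Longrightarrow> x i \<noteq> 0" "x j = 0"
      by (cases rule: claim_val_cases[where x = x and p = p]) auto
    have one: "\<forall>i<j. x i = 1"
      using j(1) x unfolding cantor_def by (metis One_nat_def le_Suc_eq le_zero_eq)
    show "x \<in> opn (claim_opn p i)"
    proof (cases "(\<lambda>n. x (Suc j + n)) \<in> cls (bfst p)")
      case True
      with i False claim_val_eq[where x = x and j = j and p = p, OF j] have "j \<le> total p" "i \<le> Suc j"
        by (auto split: if_splits)
      moreover obtain t where "seen p t = total p"
        using ex_seen_total by blast
      ultimately have "claim_opn p i (pair j (pair t 1)) = Suc (list_encode (map (\<lambda>_. 1) [0..<j] @ [0]))"
        using False by (simp add: claim_opn_def)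
      moreover have "extends x (map (\<lambda>_. 1) [0..<j] @ [0])"
        using one j(2) extends_claim[of x j "[]"] by (simp add: extends_def)
      ultimately show ?thesis
        using x unfolding opn_def by (metis (mono_tags, lifting) list_encode_inverse mem_Collect_eq)
    next
      case False2: False
      then obtain t c where t: "bfst p t = Suc c" "extends (\<lambda>n. x (Suc j + n)) (list_decode c)"
        using cantor_shift[OF x, of "Suc j"] unfolding cls_def opn_def by blast
      then have "claim_opn p i (pair j (pair t 0)) = Suc (list_encode (map (\<lambda>_. 1) [0..<j] @ 0 # list_decode c))"
        using False by (simp add: claim_opn_def)
      moreover have "extends x (map (\<lambda>_. 1) [0..<j] @ 0 # list_decode c)"
        unfolding extends_claim using one j(2) t(2) by simp
      ultimately show ?thesis
        using x unfolding opn_def by (metis (mono_tags, lifting) list_encode_inverse mem_Collect_eq)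
    qed
  qed
qed

text \<open>Player 1 secures this much by claiming exactly \<open>total p\<close>: the claim is
  supported, and an answer outside the closed set pays even more.\<close>

lemma claim_val_ge_total:
  assumes "strategy s"
    and s: "\<And>w. bword w \<Longrightarrow> 0 \<notin> set w \<Longrightarrow> s w = (if length w < total p then 1 else 0)"
  shows "Suc (total p) \<le> claim_val p (play s)"
proof -
  have one: "play s n = 1" if "n < total p" for n
    using that
  proof (induction n rule: less_induct)
    case (less n)
    then have "0 \<notin> set (map (play s) [0..<n])" by auto
    with less.prems show ?case
      using s[OF play_bword[OF assms(1)], of n] play_unfold[of s n] by simp
  qed
  then have "0 \<notin> set (map (play s) [0..<total p])" by auto
  then have "play s (total p) = 0"
    using s[OF play_bword[OF assms(1)], of "total p"] play_unfold[of s "total p"] by simp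
  then have "claim_val p (play s) = (if (\<lambda>n. play s (Suc (total p) + n)) \<notin> cls (bfst p)
      then lnum p + 2 else if total p \<le> total p then Suc (total p) else 0)"
    using one by (intro claim_val_eq) auto
  then show ?thesis using total_le[of p] by auto
qed

text \<open>After a word \<open>1^j 0 u\<close> the next entry of \<open>a\<close> is the one
  numbered by the length of \<open>u\<close>, so that the play after the claim becomes
  \<open>a\<close> itself.\<close>

definition follow :: "baire \<Rightarrow> nat list \<Rightarrow> nat" where
  "follow a w = a (length w - Suc (LEAST i. i < length w \<and> w ! i = 0))"

text \<open>If player 2 copies a point of the closed set, the best outcome is out of reach, a claim
  above \<open>total p\<close> pays 0, and any other pays at most
  \<open>Suc (total p)\<close>.\<close>

lemma claim_val_le_total:
  assumes "strategy s" and a: "a \<in> cls (bfst p)"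
    and s: "\<And>w. bword w \<Longrightarrow> 0 \<in> set w \<Longrightarrow> s w = follow a w"
  shows "claim_val p (play s) \<le> Suc (total p)"
proof (cases rule: claim_val_cases[where x = "play s" and p = p])
  case (2 j)
  have "play s (Suc j + n) = a n" for n
  proof -
    let ?w = "map (play s) [0..<Suc j + n]"
    have "(LEAST i. i < length ?w \<and> ?w ! i = 0) = j"
    proof (rule Least_equality)
      show "j < length ?w \<and> ?w ! j = 0" using 2(2) by (simp del: upt_Suc)
      show "j \<le> i" if "i < length ?w \<and> ?w ! i = 0" for i
        using that 2(1)[of i] by (auto simp del: upt_Suc intro: leI)
    qed
    moreover have "0 \<in> set ?w"
      using 2(2) by (auto simp del: upt_Suc intro!: image_eqI[of _ _ j])
    ultimately show ?thesis
      using s[OF play_bword[OF assms(1)], of "Suc j + n"] play_unfold[of s "Suc j + n"]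
      by (simp add: follow_def del: upt_Suc)
  qed
  then have "(\<lambda>n. play s (Suc j + n)) = a" by auto
  with a claim_val_eq[of j "play s" p] 2 show ?thesis by auto
qed simp

definition claim_turn :: "nat list \<Rightarrow> nat" where
  "claim_turn w = (if 0 \<in> set w then 2 else 1)"

definition claim_pref :: "nat \<Rightarrow> nat \<Rightarrow> nat \<Rightarrow> nat \<Rightarrow> bool" where
  "claim_pref m a i j \<longleftrightarrow> (if a = 1 then i < j \<and> j < m else j < i \<and> i < m)"

text \<open>The sum recovers the i for which u is the code of the upper set {i..<m} of player 1 or {..<i} of
  player 2.\<close>
definition claim_name :: "baire \<Rightarrow> baire" where
  "claim_name p k = (let c = fst (prod_decode k); n = snd (prod_decode k); m = lnum p + 3 in
     if c = 0 then m
     else if c = 1 then claim_turn (list_decode n)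
     else if c \<le> 3 then
       (if claim_pref m (c - 1) (fst (prod_decode n)) (snd (prod_decode n)) then 1 else 0)
     else let a = fst (prod_decode (fst (prod_decode n))); u = snd (prod_decode (fst (prod_decode n)));
              l = snd (prod_decode n) in
       if l = 0 then a - 1
       else claim_opn p (\<Sum>i<Suc m. if u = (if a = 1 then 2 ^ m - 2 ^ i else 2 ^ i - 1) then i else 0)
              (l - 1))"

lemma claim_name_simps:
  "claim_name p (pair 0 n) = lnum p + 3"
  "claim_name p (pair 1 (list_encode w)) = claim_turn w"
  "a \<in> {1, 2} \<Longrightarrow> claim_name p (pair (a + 1) (pair i j)) =
     (if claim_pref (lnum p + 3) a i j then 1 else 0)"
  "claim_name p (pair 4 (pair (pair a u) 0)) = a - 1"
  "claim_name p (pair 4 (pair (pair a u) (Suc l))) =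
     claim_opn p (\<Sum>i<Suc (lnum p + 3). if u = (if a = 1 then 2 ^ (lnum p + 3) - 2 ^ i else 2 ^ i - 1)
       then i else 0) l"
  by (auto simp: claim_name_def Let_def)

section \<open>Codes of upper sets and the name of the claim game\<close>

lemma setcode_lessThan: "setcode {..<i} = 2 ^ i - 1"
  unfolding setcode_def using sum_power2[of i] by (simp add: atLeast0LessThan)

lemma setcode_atLeastLessThan: "i \<le> m \<Longrightarrow> setcode {i..<m} = 2 ^ m - 2 ^ i"
  unfolding setcode_def
  by (induction m rule: dec_induct) (simp_all add: sum.atLeastLessThan_Suc)

lemma sum_select: "(\<And>j. j < m \<Longrightarrow> P j \<longleftrightarrow> j = i) \<Longrightarrow> i < m \<Longrightarrow> (\<Sum>j<m. if P j then j else 0) = (i::nat)"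
  by (subst sum.cong[of _ "{..<m}" _ "\<lambda>j. if j = i then i else 0"]) auto

lemma power2_minus_inject:
  assumes "i \<le> m" "j \<le> m" shows "(2::nat) ^ m - 2 ^ i = 2 ^ m - 2 ^ j \<longleftrightarrow> j = i"
proof
  have "(2::nat) ^ i \<le> 2 ^ m" "(2::nat) ^ j \<le> 2 ^ m"
    using assms by (simp_all add: power_increasing)
  moreover assume "(2::nat) ^ m - 2 ^ i = 2 ^ m - 2 ^ j"
  ultimately have "(2::nat) ^ i = 2 ^ j" by linarith
  then show "j = i" by simp
qed simp

lemma power2_pred_inject: "(2::nat) ^ i - 1 = 2 ^ j - 1 \<longleftrightarrow> j = i"
proof
  assume "(2::nat) ^ i - 1 = 2 ^ j - 1"
  moreover have "(1::nat) \<le> 2 ^ i" "(1::nat) \<le> 2 ^ j" by simp_all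
  ultimately have "(2::nat) ^ i = 2 ^ j" by linarith
  then show "j = i" by simp
qed simp

lemma claim_name_set:
  assumes "i \<le> lnum p + 3"
  shows "OA_name (bcomp (pair 1 (setcode {i..<lnum p + 3})) (bcomp 4 (claim_name p)))
      {x. cantor x \<and> i \<le> claim_val p x}"
    and "OA_name (bcomp (pair 2 (setcode {..<i})) (bcomp 4 (claim_name p)))
      {x. cantor x \<and> claim_val p x < i}"
proof -
  have "(\<Sum>j<Suc (lnum p + 3). if (2::nat) ^ (lnum p + 3) - 2 ^ i = 2 ^ (lnum p + 3) - 2 ^ j then j else 0) = i"
    using assms power2_minus_inject[OF assms] by (intro sum_select) auto
  then show "OA_name (bcomp (pair 1 (setcode {i..<lnum p + 3})) (bcomp 4 (claim_name p)))
      {x. cantor x \<and> i \<le> claim_val p x}"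
    unfolding OA_name_def bcomp_def setcode_atLeastLessThan[OF assms] claim_name_simps
    by (simp only: if_True simp_thms opn_claim_opn) simp
  have "(\<Sum>j<Suc (lnum p + 3). if (2::nat) ^ i - 1 = 2 ^ j - 1 then j else 0) = i"
    using assms power2_pred_inject[of i] by (intro sum_select) auto
  then have "(\<lambda>n. claim_name p (pair 4 (pair (pair 2 (setcode {..<i})) (Suc n)))) = claim_opn p i"
    unfolding claim_name_simps setcode_lessThan by simp
  moreover have "cls (claim_opn p i) = {x. cantor x \<and> claim_val p x < i}"
    unfolding cls_def opn_claim_opn by auto
  ultimately show "OA_name (bcomp (pair 2 (setcode {..<i})) (bcomp 4 (claim_name p)))
      {x. cantor x \<and> claim_val p x < i}"
    unfolding OA_name_def bcomp_def claim_name_simps by simp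
qed

lemma OA_name_unique: "OA_name r S \<Longrightarrow> OA_name r T \<Longrightarrow> S = T"
  by (auto simp: OA_name_def)

lemma upper_1_cases:
  assumes "upper m (claim_pref m 1) U" obtains i where "i \<le> m" "U = {i..<m}"
proof (cases "U = {}")
  case True
  then show ?thesis using that[of m] by simp
next
  case False
  define i where "i = (LEAST i. i \<in> U)"
  have "i \<in> U"
    unfolding i_def using False by (meson LeastI ex_in_conv)
  have "U = {i..<m}"
  proof (intro set_eqI iffI)
    fix j assume "j \<in> U"
    then show "j \<in> {i..<m}"
      using assms unfolding upper_def i_def by (auto intro: Least_le)
  next
    fix j assume "j \<in> {i..<m}"
    with \<open>i \<in> U\<close> show "j \<in> U"
      using assms unfolding upper_def claim_pref_def by (cases "j = i") auto
  qed
  moreover have "i \<le> m"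
    using \<open>i \<in> U\<close> assms unfolding upper_def by auto
  ultimately show ?thesis using that by blast
qed

text \<open>The preferences are opposite, so the complement of an upper set of player 2 is one of
  player 1.\<close>

lemma upper_2_cases:
  assumes "upper m (claim_pref m 2) U" obtains i where "i \<le> m" "U = {..<i}"
proof -
  have "i \<in> U" if "j \<in> U" "i < j" "j < m" for i j
    using assms that by (simp add: upper_def claim_pref_def)
  then have "upper m (claim_pref m 1) ({..<m} - U)"
    unfolding upper_def claim_pref_def by (simp, blast)
  then obtain i where i: "i \<le> m" "{..<m} - U = {i..<m}"
    by (rule upper_1_cases)
  have "U \<subseteq> {..<m}"
    using assms unfolding upper_def by blast
  then have "U = {..<m} - ({..<m} - U)" by auto
  also have "\<dots> = {..<i}"
    unfolding i(2) using i(1) by auto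
  finally show ?thesis using that i(1) by blast
qed

lemma upper_atLeastLessThan: "upper m (claim_pref m 1) {i..<m}"
  by (auto simp: upper_def claim_pref_def)

lemma game_name_claim_name:
  "game_name (claim_name p) (lnum p + 3) claim_turn (claim_pref (lnum p + 3)) (claim_val p)"
proof -
  let ?m = "lnum p + 3"
  have less: "claim_val p x < ?m" for x
    using claim_val_le[of p x] by linarith
  have "OA_name (bcomp (pair 1 (setcode U)) (bcomp 4 (claim_name p))) {x. cantor x \<and> claim_val p x \<in> U}"
    if "upper ?m (claim_pref ?m 1) U" for U
    using that
  proof (rule upper_1_cases)
    fix i assume "i \<le> ?m" "U = {i..<?m}"
    then show ?thesis using claim_name_set(1)[of i p] less by simp
  qed
  moreover have "OA_name (bcomp (pair 2 (setcode U)) (bcomp 4 (claim_name p))) {x. cantor x \<and> claim_val p x \<in> U}"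
    if "upper ?m (claim_pref ?m 2) U" for U
    using that
  proof (rule upper_2_cases)
    fix i assume "i \<le> ?m" "U = {..<i}"
    then show ?thesis using claim_name_set(2)[of i p] by simp
  qed
  moreover have "strict_linear ?m (claim_pref ?m 1)" "claim_pref ?m 2 i j \<longleftrightarrow> claim_pref ?m 1 j i" for i j
    unfolding strict_linear_def claim_pref_def by auto
  moreover have "claim_turn w \<in> {1, 2}" for w
    by (simp add: claim_turn_def)
  moreover have "claim_pref ?m a i j \<Longrightarrow> i < ?m \<and> j < ?m" for a i j
    unfolding claim_pref_def by (auto split: if_splits)
  ultimately show ?thesis
    using less unfolding game_name_def bcomp_def claim_name_simps
    by (auto simp: claim_name_simps(3)[of 1, simplified] claim_name_simps(3)[of 2, simplified])
qed

text \<open>A solution of \<open>NE_ap_OA\<close> is an equilibrium of some game with the given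
  name, so the name has to pin the game down. The value of a point is recovered from its membership
  in the named sets of value at least \<open>i\<close>.\<close>

lemma game_name_claim_unique:
  assumes "game_name (claim_name p) m d r v"
  shows "m = lnum p + 3" "\<And>w. bword w \<Longrightarrow> d w = claim_turn w"
    "\<And>a. a \<in> {1, 2} \<Longrightarrow> r a = claim_pref m a" "\<And>x. cantor x \<Longrightarrow> v x = claim_val p x"
proof -
  show m: "m = lnum p + 3"
    using assms unfolding game_name_def bcomp_def claim_name_simps by blast
  show "d w = claim_turn w" if "bword w" for w
    using assms that unfolding game_name_def bcomp_def claim_name_simps by blast
  show r: "r a = claim_pref m a" if "a \<in> {1, 2}" for a
  proof (intro ext)
    fix i j
    have "r a i j \<longleftrightarrow> i < m \<and> j < m \<and> claim_name p (pair (a + 1) (pair i j)) = 1"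
      using assms that unfolding game_name_def bcomp_def by blast
    then show "r a i j \<longleftrightarrow> claim_pref m a i j"
      unfolding claim_name_simps(3)[OF that] m claim_pref_def by auto
  qed
  fix x assume x: "cantor x"
  have "v x < m" "claim_val p x < m"
    using assms x claim_val_le[of p x] m unfolding game_name_def by auto
  have iff: "i \<le> v x \<longleftrightarrow> i \<le> claim_val p x" if "i < m" for i
  proof -
    have "OA_name (bcomp (pair 1 (setcode {i..<m})) (bcomp 4 (claim_name p))) {x. cantor x \<and> v x \<in> {i..<m}}"
      using assms upper_atLeastLessThan[of m i] r[of 1] unfolding game_name_def by fastforce
    then have "{x. cantor x \<and> v x \<in> {i..<m}} = {x. cantor x \<and> i \<le> claim_val p x}"
      using claim_name_set(1)[of i p] that OA_name_unique m by (metis less_imp_le)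
    then show ?thesis
      using x \<open>v x < m\<close> by auto
  qed
  from iff[OF \<open>v x < m\<close>] iff[OF \<open>claim_val p x < m\<close>] show "v x = claim_val p x"
    by (metis le_antisym order.refl)
qed

lemma nash_claim:
  assumes "game_name (claim_name p) m d r v" "nash d r v s" "a \<in> cls (bfst p)"
  shows "claim_val p (play s) = Suc (total p)"
proof -
  note g = game_name_claim_unique[OF assms(1)]
  have s: "strategy s" using assms(2) unfolding nash_def by blast
  have a: "follow a w \<le> 1" for w
    using assms(3) unfolding follow_def cls_def cantor_def by auto
  \<comment> \<open>In \<open>s1\<close> player 1 deviates to the truthful claim, in
    \<open>s2\<close> player 2 deviates to copying \<open>a\<close>. Neither deviation pays, which
    squeezes the value between two equal bounds.\<close>
  define s1 where "s1 w = (if 0 \<in> set w then s w else if length w < total p then 1 else 0)" for w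
  define s2 where "s2 w = (if 0 \<in> set w then follow a w else s w)" for w
  have s1: "strategy s1" and s2: "strategy s2"
    using s a by (auto simp: strategy_def s1_def s2_def)
  have "\<not> r 1 (v (play s)) (v (play s1))"
    using assms(2) s1 g(2) unfolding nash_def by (auto simp: s1_def claim_turn_def split: if_splits)
  moreover have "\<not> r 2 (v (play s)) (v (play s2))"
    using assms(2) s2 g(2) unfolding nash_def by (auto simp: s2_def claim_turn_def split: if_splits)
  ultimately have "claim_val p (play s1) \<le> claim_val p (play s)"
      "claim_val p (play s) \<le> claim_val p (play s2)"
    using claim_val_le[of p "play s1"] claim_val_le[of p "play s"]
    by (auto simp: g(1,3,4) cantor_play s s1 s2 claim_pref_def)
  moreover have "Suc (total p) \<le> claim_val p (play s1)"
    using s1 by (rule claim_val_ge_total) (simp add: s1_def)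
  moreover have "claim_val p (play s2) \<le> Suc (total p)"
    using s2 assms(3) by (rule claim_val_le_total) (simp add: s2_def)
  ultimately show ?thesis by linarith
qed

text \<open>The truthful claim against a copied point of the closed set is an equilibrium. This
  places \<open>claim_name p\<close> in the domain of \<open>NE_ap_OA\<close>.\<close>

lemma ex_nash_claim:
  assumes a: "a \<in> cls (bfst p)"
  shows "\<exists>s. nash claim_turn (claim_pref (lnum p + 3)) (claim_val p) s"
proof -
  define s where "s w = (if 0 \<in> set w then follow a w else if length w < total p then 1 else 0)" for w
  have "follow a w \<le> 1" for w
    using a unfolding follow_def cls_def cantor_def by auto
  then have s: "strategy s"
    by (auto simp: strategy_def s_def)
  have "Suc (total p) \<le> claim_val p (play s')" if "strategy s'" "\<forall>w. bword w \<and> claim_turn w \<noteq> 2 \<longrightarrow> s' w = s w" for s'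
    using that(1) by (rule claim_val_ge_total) (use that(2) in \<open>auto simp: s_def claim_turn_def\<close>)
  moreover have "claim_val p (play s') \<le> Suc (total p)" if "strategy s'" "\<forall>w. bword w \<and> claim_turn w \<noteq> 1 \<longrightarrow> s' w = s w" for s'
    using that(1) a by (rule claim_val_le_total) (use that(2) in \<open>auto simp: s_def claim_turn_def\<close>)
  ultimately have "nash claim_turn (claim_pref (lnum p + 3)) (claim_val p) s"
    using s unfolding nash_def claim_pref_def by (auto, (metis leD le_antisym nat_less_le not_less_eq_eq)+)
  then show ?thesis by blast
qed

section \<open>Computability of the claim game and of its evaluation\<close>

lemma computable_oracle: "computable (\<lambda>p n. p n)"
  by (rule computable_query[OF computable_id])

lemma computable_lnum:
  assumes "computable P" shows "computable (\<lambda>p x. lnum (P p))"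
  unfolding lnum_def bsnd_def by (intro computable_compose[OF assms] computable_intros)

lemma computable_lseq:
  assumes "computable P" "computable f" "computable g"
  shows "computable (\<lambda>p x. lseq (P p) (f p x) (g p x))"
  unfolding lseq_def bsnd_def
  by (intro computable_compose[OF assms(1)] computable_intros computable_slot assms)

lemma computable_seen:
  assumes "computable P" "computable f" shows "computable (\<lambda>p x. seen (P p) (f p x))"
  unfolding seen_def
  by (intro computable_intros computable_lnum computable_lseq computable_compose[OF assms(2)] assms)

lemma computable_claim_opn:
  assumes "computable f" "computable g" shows "computable (\<lambda>p x. claim_opn p (f p x) (g p x))"
  unfolding claim_opn_def
  by (intro computable_intros computable_lnum computable_seen computable_oracle
      computable_compose[OF computable_bfst] computable_compose[OF assms(2)] assms)

lemma computable_claim_name: "computable claim_name"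
  unfolding claim_name_def Let_def claim_turn_def claim_pref_def
  by (intro computable_intros computable_lnum computable_claim_opn computable_oracle)

lemma play_prefix_rec: "play_prefix s n = rec_nat [] (\<lambda>i r. r @ [s r]) n"
  by (induction n) auto

lemma computable_play:
  assumes "computable Q" "computable f"
  shows "computable (\<lambda>p x. play (\<lambda>w. Q p (list_encode w)) (f p x))"
  unfolding play_def play_prefix_rec
  by (intro computable_compose[OF assms(1)] computable_intros computable_rec_nat assms)

abbreviation strat :: "baire \<Rightarrow> nat list \<Rightarrow> nat" where
  "strat q \<equiv> \<lambda>w. q (list_encode w)"

text \<open>\<open>t\<close> pairs the claim made in the equilibrium with a stage by which that many
  sequences are seen to be nonzero. As the claim is exact, such a stage exists and settles every
  sequence.\<close>

definition claim_ok :: "baire \<Rightarrow> nat \<Rightarrow> bool" where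
  "claim_ok z t \<longleftrightarrow> seen (bfst z) (snd (prod_decode t)) = fst (prod_decode t) \<and>
     play (strat (bsnd z)) (fst (prod_decode t)) = 0 \<and>
     (\<forall>i<fst (prod_decode t). play (strat (bsnd z)) i \<noteq> 0)"

text \<open>Even positions carry the point played after the claim, odd ones the LPO answers. An
  answer is constrained only at its entry 0, so all other odd positions may hold the default
  1.\<close>

definition claim_out :: "baire \<Rightarrow> nat \<Rightarrow> nat \<Rightarrow> nat" where
  "claim_out z t k =
     (if even k then play (strat (bsnd z)) (Suc (fst (prod_decode t)) + k div 2)
      else if \<exists>i\<le>k div 2. i < lnum (bfst z) \<and> k div 2 = slot i 0 \<and>
          (\<exists>n<snd (prod_decode t). lseq (bfst z) i n \<noteq> 0) then 0 else 1)"

lemma computable_claim_ok: "computable claim_ok"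
  unfolding claim_ok_def
  by (intro computable_intros computable_seen computable_bfst computable_play computable_bsnd)

lemma computable_claim_out: "computable (\<lambda>p z. claim_out p (fst z) (snd z))"
  unfolding claim_out_def
  by (intro computable_intros computable_lnum computable_lseq computable_slot computable_bfst
      computable_play computable_bsnd)

theorem C_LPO_le_NE: "(C_cantor \<times>\<^sub>W pstar LPO) \<le>\<^sub>W NE_ap_OA"
proof -
  obtain eH where H: "\<And>p. machine_out eH p (claim_name p)"
    using machine_total_out[OF computable_claim_name] by blast
  obtain eK where K: "\<And>z. \<exists>t. claim_ok z t \<Longrightarrow> machine_out eK z (claim_out z (LEAST t. claim_ok z t))"
    using machine_search_out[OF computable_claim_ok computable_claim_out] by blast
  have "\<exists>h. machine_out eH p h \<and> h \<in> pdom NE_ap_OA \<and>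
      (\<exists>r. machine_out eK (bpair p (G h)) r \<and> (C_cantor \<times>\<^sub>W pstar LPO) p r)"
    if G: "realizer NE_ap_OA G" and p: "p \<in> pdom (C_cantor \<times>\<^sub>W pstar LPO)" for G p
  proof -
    obtain a where a: "a \<in> cls (bfst p)" and e: "\<And>i. i < lnum p \<Longrightarrow> cantor (lseq p i)"
      using p unfolding pdom_def pprod_def C_cantor_def pstar_LPO_iff lnum_def lseq_def by blast
    obtain s where "nash claim_turn (claim_pref (lnum p + 3)) (claim_val p) s"
      using ex_nash_claim[OF a] by blast
    then have "NE_ap_OA (claim_name p) (\<lambda>c. s (list_decode c))"
      unfolding NE_ap_OA_def using game_name_claim_name by fastforce
    then have dom: "claim_name p \<in> pdom NE_ap_OA"
      unfolding pdom_def by blast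
    define q where "q = G (claim_name p)"
    have "NE_ap_OA (claim_name p) q"
      using G dom unfolding realizer_def q_def by blast
    then obtain m d r v where g: "game_name (claim_name p) m d r v" "nash d r v (strat q)"
      unfolding NE_ap_OA_def by blast
    define x where "x = play (strat q)"
    have val: "claim_val p x = Suc (total p)"
      unfolding x_def using nash_claim[OF g a] .
    then obtain j where j: "\<And>i. i < j \<Longrightarrow> x i \<noteq> 0" "x j = 0"
      by (cases rule: claim_val_cases[where x = x and p = p]) auto
    have y: "(\<lambda>n. x (Suc j + n)) \<in> cls (bfst p)" and jt: "j = total p"
      using val claim_val_eq[of j x p, OF j] total_le[of p] by (auto split: if_splits)
    obtain t0 where "seen p t0 = total p"
      using ex_seen_total by blast
    with j jt have "claim_ok (bpair p q) (pair j t0)"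
      unfolding claim_ok_def x_def by auto
    then have ex: "\<exists>t. claim_ok (bpair p q) t" by blast
    define t where "t = (LEAST t. claim_ok (bpair p q) t)"
    have ok: "claim_ok (bpair p q) t"
      unfolding t_def using ex by (rule LeastI_ex)
    \<comment> \<open>The machine finds the least accepted \<open>t\<close>, which need not be the
      pair just exhibited. Its first component is \<open>j\<close> all the same, since the first
      zero of the play is unique.\<close>
    have tj: "fst (prod_decode t) = j"
      using ok j unfolding claim_ok_def bsnd_bpair x_def[symmetric] by (metis linorder_neqE_nat)
    then have seen: "seen p (snd (prod_decode t)) = total p"
      using ok jt unfolding claim_ok_def by simp
    let ?r = "claim_out (bpair p q) t"
    have "bfst ?r = (\<lambda>n. x (Suc j + n))"
      unfolding bfst_def claim_out_def tj x_def by simp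
    then have C: "C_cantor (bfst p) (bfst ?r)"
      using y unfolding C_cantor_def by auto
    have "bsnd ?r (slot i 0) = (if \<forall>n. lseq p i n = 0 then 1 else 0)" if "i < lnum p" for i
    proof -
      have "bsnd ?r (slot i 0) = (if \<exists>k\<le>slot i 0. k < lnum p \<and> slot i 0 = slot k 0 \<and>
          (\<exists>n<snd (prod_decode t). lseq p k n \<noteq> 0) then 0 else 1)"
        unfolding bsnd_def claim_out_def by simp
      also have "(\<exists>k\<le>slot i 0. k < lnum p \<and> slot i 0 = slot k 0 \<and>
          (\<exists>n<snd (prod_decode t). lseq p k n \<noteq> 0)) \<longleftrightarrow> (\<exists>n<snd (prod_decode t). lseq p i n \<noteq> 0)"
        unfolding slot_inject using that le_slot(1) by blast
      also have "\<dots> \<longleftrightarrow> (\<exists>n. lseq p i n \<noteq> 0)"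
        using seen_eq_total[OF seen that] .
      finally show ?thesis by auto
    qed
    then have "pstar LPO (bsnd p) (bsnd ?r)"
      using e unfolding pstar_LPO_iff lnum_def lseq_def by blast
    with C have "(C_cantor \<times>\<^sub>W pstar LPO) p ?r"
      unfolding pprod_def by blast
    moreover have "machine_out eK (bpair p q) ?r"
      unfolding t_def using K[OF ex] .
    ultimately show ?thesis
      using H dom unfolding q_def by blast
  qed
  then show ?thesis
    unfolding weihrauch_le_def by blast
qed

section \<open>Open games\<close>

text \<open>Some play that agrees with s at the positions of player c runs through u.\<close>
definition hits :: "(nat list \<Rightarrow> nat) \<Rightarrow> nat \<Rightarrow> (nat list \<Rightarrow> nat) \<Rightarrow> nat list \<Rightarrow> bool" where
  "hits d c s u \<longleftrightarrow> bword u \<and> (\<forall>j<length u. d (take j u) = c \<longrightarrow> s (take j u) = u ! j)"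

lemma extends_iff: "extends x u \<longleftrightarrow> map x [0..<length u] = u"
  unfolding extends_def list_eq_iff_nth_eq by simp

lemma bword_take: "bword u \<Longrightarrow> bword (take j u)"
  unfolding bword_iff by (auto dest: in_set_takeD)

lemma hits_play:
  assumes "strategy s'" "\<And>w. bword w \<Longrightarrow> d w = c \<Longrightarrow> s' w = s w" "extends (play s') u"
  shows "hits d c s u"
proof -
  have u: "u = map (play s') [0..<length u]"
    using assms(3) by (simp add: extends_iff)
  then have "bword u"
    using play_bword[OF assms(1)] by metis
  moreover have "s (take j u) = u ! j" if "j < length u" "d (take j u) = c" for j
  proof -
    have "take j u = map (play s') [0..<j]"
      by (subst u) (use that(1) in \<open>simp add: take_map\<close>)
    then have "play s' j = s' (take j u)"
      using play_unfold[of s' j] by simp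
    also have "\<dots> = s (take j u)"
      using assms(2) that(2) bword_take[OF \<open>bword u\<close>] by blast
    finally show ?thesis
      using assms(3) that(1) by (simp add: extends_def)
  qed
  ultimately show ?thesis by (simp add: hits_def)
qed

definition covered :: "baire \<Rightarrow> nat \<Rightarrow> nat list \<Rightarrow> bool" where
  "covered W t u \<longleftrightarrow> (\<exists>i\<le>t. W i \<noteq> 0 \<and>
     take (length (list_decode (W i - 1))) u = list_decode (W i - 1))"

text \<open>The finite tree T (given by the codes of its nodes) is closed under one move of the opponent
  of c and under all moves of c, except at nodes that already lie in the open set.\<close>
definition forcing :: "(nat list \<Rightarrow> nat) \<Rightarrow> nat \<Rightarrow> baire \<Rightarrow> nat \<Rightarrow> nat list \<Rightarrow> bool" where
  "forcing d c W t T \<longleftrightarrow> (\<forall>k\<in>set T. covered W t (list_decode k) \<or>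
     (if d (list_decode k) = c
      then list_encode (list_decode k @ [0]) \<in> set T \<and> list_encode (list_decode k @ [1]) \<in> set T
      else list_encode (list_decode k @ [0]) \<in> set T \<or> list_encode (list_decode k @ [1]) \<in> set T))"

text \<open>At an uncovered tree node of the opponent some successor is in the tree; if it is not
  the one for 1, then it is the one for 0, so the default 0 stays in the tree.\<close>

definition tree_strategy :: "nat list \<Rightarrow> nat list \<Rightarrow> nat" where
  "tree_strategy T w = (if list_encode (w @ [1]) \<in> set T then 1 else 0)"

lemma take_prefix_imp_extends:
  assumes "take (length w) (map x [0..<n]) = w" shows "extends x w"
proof -
  have "length w \<le> n"
    using arg_cong[OF assms, of length] by simp
  then show ?thesis
    using assms by (simp add: extends_iff take_map)
qed

text \<open>The code 0 is the empty word, so the root is in the tree. A play that is never covered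
  would remain in the tree and thus visit infinitely many distinct nodes of a finite list.\<close>

lemma forcing_play:
  assumes T: "forcing d c W t T" "0 \<in> set T" and s: "strategy s"
    and s_tree: "\<And>w. bword w \<Longrightarrow> d w \<noteq> c \<Longrightarrow> s w = tree_strategy T w"
  shows "\<exists>i\<le>t. W i \<noteq> 0 \<and> extends (play s) (list_decode (W i - 1))"
proof (rule ccontr)
  assume "\<not> ?thesis"
  then have uncovered: "\<not> covered W t (map (play s) [0..<n])" for n
    unfolding covered_def using take_prefix_imp_extends by blast
  have mem: "list_encode (map (play s) [0..<n]) \<in> set T" for n
  proof (induction n)
    case 0
    then show ?case using T(2) by simp
  next
    case (Suc n)
    let ?u = "map (play s) [0..<n]"
    have u: "if d ?u = c then list_encode (?u @ [0]) \<in> set T \<and> list_encode (?u @ [1]) \<in> set T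
        else list_encode (?u @ [0]) \<in> set T \<or> list_encode (?u @ [1]) \<in> set T"
      using T(1) Suc uncovered[of n] unfolding forcing_def by force
    have "play s n = 0 \<or> play s n = 1"
      using cantor_play[OF s] unfolding cantor_def by (metis le_SucE le_zero_eq One_nat_def)
    moreover have "play s n = tree_strategy T ?u" if "d ?u \<noteq> c"
      using play_unfold[of s n] s_tree[OF play_bword[OF s] that] by simp
    ultimately have "list_encode (?u @ [play s n]) \<in> set T"
      using u unfolding tree_strategy_def by (metis (full_types))
    then show ?case by simp
  qed
  have "inj (\<lambda>n. list_encode (map (play s) [0..<n]))"
    by (rule injI) (metis diff_zero length_map length_upt list_encode_inverse)
  moreover have "range (\<lambda>n. list_encode (map (play s) [0..<n])) \<subseteq> set T"
    using mem by blast
  ultimately show False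
    by (meson List.finite_set finite_imageD infinite_UNIV_nat finite_subset)
qed

text \<open>Let \<open>S\<close> play against the tree strategy: the play enters a listed word,
  which \<open>S\<close> therefore hits. So no strategy of \<open>c\<close> avoids all words up to
  stage \<open>t\<close>.\<close>

lemma forcing_hits:
  assumes "forcing d c W t T" "0 \<in> set T" and S: "\<And>w. S w \<le> 1"
  shows "\<exists>i\<le>t. W i \<noteq> 0 \<and> hits d c S (list_decode (W i - 1))"
proof -
  define s where "s w = (if d w = c then S w else tree_strategy T w)" for w
  have s: "strategy s"
    using S by (auto simp: strategy_def s_def tree_strategy_def)
  obtain i where "i \<le> t" "W i \<noteq> 0" "extends (play s) (list_decode (W i - 1))"
    using forcing_play[OF assms(1,2) s] by (auto simp: s_def)
  moreover from this have "hits d c S (list_decode (W i - 1))"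
    using s by (intro hits_play[of s]) (auto simp: s_def)
  ultimately show ?thesis by blast
qed

lemma covered_mono: "covered W t u \<Longrightarrow> t \<le> t' \<Longrightarrow> covered W t' u"
  unfolding covered_def by (meson order.trans)

lemma forcing_union:
  assumes "forcing d c W t T" "forcing d c W t' T'" shows "forcing d c W (max t t') (T @ T')"
  using assms covered_mono[of W t _ "max t t'"] covered_mono[of W t' _ "max t t'"]
  unfolding forcing_def by (auto split: if_splits)

lemma forcing_insert:
  assumes "forcing d c W t T"
    and "if d u = c then list_encode (u @ [0]) \<in> set T \<and> list_encode (u @ [1]) \<in> set T
      else list_encode (u @ [0]) \<in> set T \<or> list_encode (u @ [1]) \<in> set T"
  shows "forcing d c W t (list_encode u # T)"
  using assms unfolding forcing_def by (auto split: if_splits)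

text \<open>If the opponent of c cannot force from u, then c can move to a successor with the same
  property: c wins the closed game by staying at such positions.\<close>
lemma open_game_determined:
  assumes no_tree: "\<not> (\<exists>t T. forcing d c W t T \<and> 0 \<in> set T)"
  shows "\<exists>S. (\<forall>w. S w \<le> 1) \<and> (\<forall>t. W t \<noteq> 0 \<longrightarrow> \<not> hits d c S (list_decode (W t - 1)))"
proof -
  \<comment> \<open>The tree must contain \<open>u\<close> but need not have it as its root; this
    lets trees be merged and enlarged freely.\<close>
  define wins where "wins u \<longleftrightarrow> (\<exists>t T. forcing d c W t T \<and> list_encode u \<in> set T)" for u
  have wins_up: "wins u" if "if d u = c then wins (u @ [0]) \<and> wins (u @ [1]) else wins (u @ [0]) \<or> wins (u @ [1])" for u
  proof (cases "d u = c")
    case True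
    with that obtain t T t' T' where "forcing d c W t T" "list_encode (u @ [0]) \<in> set T"
      "forcing d c W t' T'" "list_encode (u @ [1]) \<in> set T'"
      unfolding wins_def by auto
    then have "forcing d c W (max t t') (list_encode u # T @ T')"
      using True by (intro forcing_insert forcing_union) auto
    then show ?thesis unfolding wins_def by fastforce
  next
    case False
    with that obtain t T where "forcing d c W t T"
      "list_encode (u @ [0]) \<in> set T \<or> list_encode (u @ [1]) \<in> set T"
      unfolding wins_def by auto
    then have "forcing d c W t (list_encode u # T)"
      using False by (intro forcing_insert) auto
    then show ?thesis unfolding wins_def by fastforce
  qed
  define S where "S w = (if wins (w @ [0]) then 1 else 0 :: nat)" for w
  have "\<not> hits d c S (list_decode (W t - 1))" if "W t \<noteq> 0" for t
  proof
    define u where "u = list_decode (W t - 1)"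
    assume "hits d c S (list_decode (W t - 1))"
    then have u: "bword u" "\<And>j. j < length u \<Longrightarrow> d (take j u) = c \<Longrightarrow> S (take j u) = u ! j"
      unfolding hits_def u_def by auto
    have "\<not> wins (take j u)" if "j \<le> length u" for j
      using that
    proof (induction j)
      case 0
      then show ?case using no_tree unfolding wins_def by auto
    next
      case (Suc j)
      then have j: "j < length u" "\<not> wins (take j u)" by auto
      have bit: "u ! j = 0 \<or> u ! j = 1"
        using u(1) j(1) nth_mem unfolding bword_def by blast
      have "\<not> wins (take j u @ [u ! j])"
      proof (cases "d (take j u) = c")
        case True
        then have "u ! j = (if wins (take j u @ [0]) then 1 else 0)"
          using u(2)[OF j(1)] by (simp add: S_def)
        then show ?thesis
          using wins_up[of "take j u"] True j(2) by (metis (full_types))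
      next
        case False
        then show ?thesis
          using wins_up[of "take j u"] j(2) bit by auto
      qed
      then show ?case using j(1) by (simp add: take_Suc_conv_app_nth)
    qed
    from this[of "length u"] have "\<not> wins u" by simp
    \<comment> \<open>The word \<open>u\<close> is itself listed at stage \<open>t\<close>, so the
      single node \<open>u\<close> is covered and forms a forcing tree.\<close>
    moreover have "forcing d c W t [list_encode u]"
      using that unfolding forcing_def covered_def u_def by auto
    ultimately show False unfolding wins_def by fastforce
  qed
  moreover have "\<forall>w. S w \<le> 1" by (simp add: S_def)
  ultimately show ?thesis by blast
qed

text \<open>One point of Cantor space stores a strategy for every threshold \<open>k\<close> at
  once, so that a single instance of closed choice serves all of them.\<close>

definition coord :: "nat \<Rightarrow> nat list \<Rightarrow> nat" where "coord k w = pair k (list_encode w)"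

text \<open>\<open>prefix_hits\<close> and \<open>prefix_misses\<close> are decidable on a finite
  part \<open>z\<close> of the stored strategies. Both fail as long as \<open>z\<close> is too short
  to settle the matter.\<close>

definition prefix_hits :: "(nat list \<Rightarrow> nat) \<Rightarrow> nat \<Rightarrow> nat \<Rightarrow> nat list \<Rightarrow> nat list \<Rightarrow> bool" where
  "prefix_hits d c k z u \<longleftrightarrow> bword u \<and> (\<forall>j<length u. d (take j u) = c \<longrightarrow>
     coord k (take j u) < length z \<and> getarg (coord k (take j u)) z = getarg j u)"

definition prefix_misses :: "(nat list \<Rightarrow> nat) \<Rightarrow> nat \<Rightarrow> nat \<Rightarrow> nat list \<Rightarrow> nat list \<Rightarrow> bool" where
  "prefix_misses d c k z u \<longleftrightarrow> (bword u \<longrightarrow> (\<exists>j<length u. d (take j u) = c \<and>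
     coord k (take j u) < length z \<and> getarg (coord k (take j u)) z \<noteq> getarg j u))"

lemma extends_getarg: "extends x z \<Longrightarrow> n < length z \<Longrightarrow> getarg n z = x n"
  by (simp add: extends_def getarg_def)

lemma getarg_nth: "j < length u \<Longrightarrow> getarg j u = u ! j"
  by (simp add: getarg_def)

lemma prefix_hits_imp_hits:
  assumes "prefix_hits d c k z u" "extends x z" shows "hits d c (\<lambda>w. x (coord k w)) u"
  using assms(1) extends_getarg[OF assms(2)] unfolding prefix_hits_def hits_def
  by (auto simp: getarg_nth)

lemma prefix_misses_imp_not_hits:
  assumes "prefix_misses d c k z u" "extends x z" shows "\<not> hits d c (\<lambda>w. x (coord k w)) u"
  using assms(1) extends_getarg[OF assms(2)] unfolding prefix_misses_def hits_def
  by (auto simp: getarg_nth)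

lemma extends_prefix: "extends x (map x [0..<n])"
  by (simp add: extends_def)

lemma hits_imp_prefix_hits:
  assumes "hits d c (\<lambda>w. x (coord k w)) u" shows "\<exists>n. prefix_hits d c k (map x [0..<n]) u"
proof -
  define n where "n = Suc (\<Sum>j<length u. coord k (take j u))"
  have "coord k (take j u) < n" if "j < length u" for j
    using member_le_sum[of j "{..<length u}" "\<lambda>j. coord k (take j u)"] that by (simp add: n_def)
  then have "prefix_hits d c k (map x [0..<n]) u"
    using assms unfolding prefix_hits_def hits_def by (auto simp: getarg_def)
  then show ?thesis ..
qed

text \<open>The miss persists on all longer prefixes, so one prefix can witness it for finitely many
  words together.\<close>

lemma not_hits_imp_prefix_misses:
  assumes "\<not> hits d c (\<lambda>w. x (coord k w)) u" shows "\<exists>N. \<forall>n\<ge>N. prefix_misses d c k (map x [0..<n]) u"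
proof (cases "bword u")
  case True
  with assms obtain j where "j < length u" "d (take j u) = c" "x (coord k (take j u)) \<noteq> u ! j"
    unfolding hits_def by auto
  then have "prefix_misses d c k (map x [0..<n]) u" if "Suc (coord k (take j u)) \<le> n" for n
    using that unfolding prefix_misses_def by (auto simp: getarg_def intro!: exI[of _ j])
  then show ?thesis by blast
qed (simp add: prefix_misses_def)

text \<open>The first t + 1 words can be avoided; the word at t may then be forbidden while some
  strategy still obeys all prohibitions issued so far.\<close>
definition avoidable :: "(nat list \<Rightarrow> nat) \<Rightarrow> nat \<Rightarrow> nat \<Rightarrow> baire \<Rightarrow> nat \<Rightarrow> nat list \<Rightarrow> bool" where
  "avoidable d c k W t \<sigma> \<longleftrightarrow> bword \<sigma> \<and>
     (\<forall>i\<le>t. W i = 0 \<or> prefix_misses d c k \<sigma> (list_decode (W i - 1)))"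

definition safe :: "(nat list \<Rightarrow> nat) \<Rightarrow> nat \<Rightarrow> nat \<Rightarrow> baire \<Rightarrow> (nat list \<Rightarrow> nat) \<Rightarrow> bool" where
  "safe d c k W S \<longleftrightarrow> (\<forall>t \<sigma>. W t \<noteq> 0 \<longrightarrow> avoidable d c k W t \<sigma> \<longrightarrow> \<not> hits d c S (list_decode (W t - 1)))"

lemma ex_bounded_nat_greatest: "P (k::nat) \<Longrightarrow> (\<And>i. P i \<Longrightarrow> i \<le> b) \<Longrightarrow> \<exists>m. P m \<and> (\<forall>i. P i \<longrightarrow> i \<le> m)"
  using Greatest_le_nat[of P _ b] GreatestI_nat[of P k b] by blast

text \<open>If the opponent has no forcing tree, a strategy that avoids every word is safe. If there
  is one, \<open>forcing_hits\<close> bounds the stages that are avoidable. A witness for the last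
  such stage misses all words up to it, and no later word is ever forbidden.\<close>

lemma ex_safe: "\<exists>S. (\<forall>w. S w \<le> 1) \<and> safe d c k W S"
proof (cases "\<exists>t T. forcing d c W t T \<and> 0 \<in> set T")
  case False
  then show ?thesis
    using open_game_determined[OF False] unfolding safe_def by blast
next
  case True
  then obtain t1 T where T: "forcing d c W t1 T" "0 \<in> set T" by blast
  \<comment> \<open>Padding with zeros makes the finite witness total; the misses recorded in it do
    not depend on the padding.\<close>
  define ext where "ext \<sigma> n = (if n < length \<sigma> then \<sigma> ! n else 0 :: nat)" for \<sigma> n
  have ext: "extends (ext \<sigma>) \<sigma>" for \<sigma>
    by (simp add: extends_def ext_def)
  have ext_le: "ext \<sigma> n \<le> 1" if "bword \<sigma>" for \<sigma> n
    using that nth_mem unfolding bword_iff ext_def by auto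
  have miss: "\<not> hits d c (\<lambda>w. ext \<sigma> (coord k w)) (list_decode (W i - 1))"
    if "avoidable d c k W t \<sigma>" "i \<le> t" "W i \<noteq> 0" for \<sigma> t i
  proof -
    have "prefix_misses d c k \<sigma> (list_decode (W i - 1))"
      using that unfolding avoidable_def by auto
    then show ?thesis by (rule prefix_misses_imp_not_hits[OF _ ext])
  qed
  have bound: "t \<le> t1" if av: "avoidable d c k W t \<sigma>" for t \<sigma>
  proof (rule ccontr)
    assume "\<not> t \<le> t1"
    have "ext \<sigma> (coord k w) \<le> 1" for w
      using av unfolding avoidable_def by (intro ext_le) simp
    from forcing_hits[OF T, of "\<lambda>w. ext \<sigma> (coord k w)", OF this]
    obtain i where i: "i \<le> t1" "W i \<noteq> 0" "hits d c (\<lambda>w. ext \<sigma> (coord k w)) (list_decode (W i - 1))"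
      by blast
    with miss[OF av, of i] \<open>\<not> t \<le> t1\<close> show False by linarith
  qed
  show ?thesis
  proof (cases "\<exists>t \<sigma>. avoidable d c k W t \<sigma>")
    case True
    then obtain t where t: "\<exists>\<sigma>. avoidable d c k W t \<sigma>" "\<And>i. \<exists>\<sigma>. avoidable d c k W i \<sigma> \<Longrightarrow> i \<le> t"
      using ex_bounded_nat_greatest[of "\<lambda>t. \<exists>\<sigma>. avoidable d c k W t \<sigma>" _ t1] bound by metis
    then obtain \<sigma> where \<sigma>: "avoidable d c k W t \<sigma>" by blast
    have "safe d c k W (\<lambda>w. ext \<sigma> (coord k w))"
      unfolding safe_def using t(2) miss[OF \<sigma>] by blast
    moreover have "ext \<sigma> (coord k w) \<le> 1" for w
      using \<sigma> unfolding avoidable_def by (intro ext_le) simp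
    ultimately show ?thesis by (intro exI[of _ "\<lambda>w. ext \<sigma> (coord k w)"]) simp
  next
    case False
    then have "safe d c k W (\<lambda>w. 0)" unfolding safe_def by blast
    then show ?thesis by (intro exI[of _ "\<lambda>w. 0"]) simp
  qed
qed

text \<open>If \<open>c\<close> wins, finite parts of a winning strategy witness that every stage is
  avoidable. Then every listed word is forbidden, and a safe strategy is winning.\<close>

lemma safe_imp_not_hits:
  assumes "safe d c k W S" and no_tree: "\<not> (\<exists>t T. forcing d c W t T \<and> 0 \<in> set T)" and "W t \<noteq> 0"
  shows "\<not> hits d c S (list_decode (W t - 1))"
proof -
  obtain S' where S': "\<forall>w. S' w \<le> 1" "\<forall>t. W t \<noteq> 0 \<longrightarrow> \<not> hits d c S' (list_decode (W t - 1))"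
    using open_game_determined[OF no_tree] by (elim exE conjE)
  \<comment> \<open>Only the word component of an index is read, so \<open>x\<close> stores
    \<open>S'\<close> under every threshold, in particular under \<open>k\<close>.\<close>
  define x where "x n = S' (list_decode (snd (prod_decode n)))" for n
  have "(\<lambda>w. x (coord k w)) = S'"
    by (simp add: x_def coord_def)
  then have "\<exists>N. \<forall>n\<ge>N. prefix_misses d c k (map x [0..<n]) (list_decode (W i - 1))" if "W i \<noteq> 0" for i
    using not_hits_imp_prefix_misses[of d c x k] S'(2) that by simp
  then obtain N where N: "\<And>i n. W i \<noteq> 0 \<Longrightarrow> N i \<le> n \<Longrightarrow> prefix_misses d c k (map x [0..<n]) (list_decode (W i - 1))"
    by metis
  define n where "n = (\<Sum>i\<le>t. N i)"
  have "N i \<le> n" if "i \<le> t" for i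
    using member_le_sum[of i "{..t}" N] that by (simp add: n_def)
  moreover have "bword (map x [0..<n])"
    using S'(1) by (auto simp: bword_iff x_def)
  ultimately have "avoidable d c k W t (map x [0..<n])"
    using N unfolding avoidable_def by blast
  then show ?thesis
    using assms(1,3) unfolding safe_def by blast
qed

section \<open>Equilibria from closed choice and LPO\<close>

definition gnum :: "baire \<Rightarrow> nat" where "gnum p = p (pair 0 0)"
definition gturn :: "baire \<Rightarrow> nat list \<Rightarrow> nat" where "gturn p w = p (pair 1 (list_encode w))"

definition gpref :: "baire \<Rightarrow> nat \<Rightarrow> nat \<Rightarrow> bool" where
  "gpref p i j \<longleftrightarrow> i < gnum p \<and> j < gnum p \<and> p (pair 2 (pair i j)) = 1"

definition gup :: "baire \<Rightarrow> nat \<Rightarrow> nat set" where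
  "gup p k = {j. j < gnum p \<and> (j = k \<or> gpref p k j)}"

text \<open>The sum is \<open>setcode (gup p k)\<close>, computed from the preference table. It
  locates, inside the name of the game, the name of the plays that player 1 likes at least as much
  as \<open>k\<close>.\<close>

definition gname :: "baire \<Rightarrow> nat \<Rightarrow> baire" where
  "gname p k n = p (pair 4 (pair (pair 1 (\<Sum>j<gnum p. if j = k \<or> gpref p k j then 2 ^ j else 0)) n))"

definition gword :: "baire \<Rightarrow> nat \<Rightarrow> baire" where "gword p k t = gname p k (Suc t)"

text \<open>The player for whom the winning set of the win/lose game with threshold k is closed, where
  player 1 aims at an outcome at least k.\<close>
definition closer :: "baire \<Rightarrow> nat \<Rightarrow> nat" where
  "closer p k = (if gname p k 0 = 0 then 2 else 1)"

lemma setcode_gup: "setcode (gup p k) = (\<Sum>j<gnum p. if j = k \<or> gpref p k j then 2 ^ j else 0)"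
proof -
  have "gup p k = {..<gnum p} \<inter> {j. j = k \<or> gpref p k j}"
    unfolding gup_def by auto
  then show ?thesis
    unfolding setcode_def by (simp add: sum.inter_restrict)
qed

text \<open>The cylinder of \<open>z\<close> is removed once the strategy for \<open>k\<close>
  stored in \<open>z\<close> is seen to hit word \<open>t\<close>; \<open>\<sigma>\<close> is the
  finite evidence that the words up to \<open>t\<close> can be avoided.\<close>

definition strategy_entry :: "baire \<Rightarrow> nat \<Rightarrow> nat \<Rightarrow> nat list \<Rightarrow> nat list \<Rightarrow> nat" where
  "strategy_entry p k t \<sigma> z =
     (if k < gnum p \<and> gword p k t \<noteq> 0 \<and> avoidable (gturn p) (closer p k) k (gword p k) t \<sigma> \<and>
        prefix_hits (gturn p) (closer p k) k z (list_decode (gword p k t - 1))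
      then Suc (list_encode z) else 0)"

definition strategies_name :: "baire \<Rightarrow> baire" where
  "strategies_name p n = strategy_entry p (fst (prod_decode n)) (fst (prod_decode (snd (prod_decode n))))
     (list_decode (fst (prod_decode (snd (prod_decode (snd (prod_decode n)))))))
     (list_decode (snd (prod_decode (snd (prod_decode (snd (prod_decode n)))))))"

lemma strategies_nameE:
  assumes "strategies_name p n = Suc c"
  obtains k t \<sigma> where "k < gnum p" "gword p k t \<noteq> 0"
    "avoidable (gturn p) (closer p k) k (gword p k) t \<sigma>"
    "prefix_hits (gturn p) (closer p k) k (list_decode c) (list_decode (gword p k t - 1))"
  using assms unfolding strategies_name_def strategy_entry_def
  by (auto split: if_splits)

lemma strategies_name_eq:
  "strategies_name p (pair k (pair t (pair (list_encode \<sigma>) (list_encode z)))) = strategy_entry p k t \<sigma> z"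
  by (simp add: strategies_name_def)

lemma cls_strategies_name:
  "x \<in> cls (strategies_name p) \<longleftrightarrow> cantor x \<and>
     (\<forall>k<gnum p. safe (gturn p) (closer p k) k (gword p k) (\<lambda>w. x (coord k w)))"
proof (intro iffI conjI allI impI)
  assume x: "x \<in> cls (strategies_name p)"
  then show c: "cantor x" by (simp add: cls_def)
  fix k assume k: "k < gnum p"
  show "safe (gturn p) (closer p k) k (gword p k) (\<lambda>w. x (coord k w))"
    unfolding safe_def
  proof (intro allI impI notI)
    fix t \<sigma>
    assume t: "gword p k t \<noteq> 0" "avoidable (gturn p) (closer p k) k (gword p k) t \<sigma>"
      "hits (gturn p) (closer p k) (\<lambda>w. x (coord k w)) (list_decode (gword p k t - 1))"
    from hits_imp_prefix_hits[OF t(3)] obtain n where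
      "prefix_hits (gturn p) (closer p k) k (map x [0..<n]) (list_decode (gword p k t - 1))" ..
    then have "strategies_name p (pair k (pair t (pair (list_encode \<sigma>) (list_encode (map x [0..<n]))))) =
        Suc (list_encode (map x [0..<n]))"
      unfolding strategies_name_eq strategy_entry_def using k t by simp
    moreover have "extends x (list_decode (list_encode (map x [0..<n])))"
      unfolding list_encode_inverse by (rule extends_prefix)
    ultimately have "x \<in> opn (strategies_name p)"
      using c unfolding opn_def by blast
    with x show False by (simp add: cls_def)
  qed
next
  assume x: "cantor x \<and> (\<forall>k<gnum p. safe (gturn p) (closer p k) k (gword p k) (\<lambda>w. x (coord k w)))"
  have "x \<notin> opn (strategies_name p)"
  proof
    assume "x \<in> opn (strategies_name p)"
    then obtain n c where c: "strategies_name p n = Suc c" "extends x (list_decode c)"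
      unfolding opn_def by blast
    from c(1) obtain k t \<sigma> where k: "k < gnum p" "gword p k t \<noteq> 0"
      "avoidable (gturn p) (closer p k) k (gword p k) t \<sigma>"
      "prefix_hits (gturn p) (closer p k) k (list_decode c) (list_decode (gword p k t - 1))"
      by (rule strategies_nameE)
    with x prefix_hits_imp_hits[OF k(4) c(2)] show False
      unfolding safe_def by blast
  qed
  with x show "x \<in> cls (strategies_name p)" by (simp add: cls_def)
qed

lemma cls_strategies_nonempty: "cls (strategies_name p) \<noteq> {}"
proof -
  have "\<exists>S. (\<forall>w. S w \<le> 1) \<and> safe (gturn p) (closer p k) k (gword p k) S" for k
    by (rule ex_safe)
  then obtain S where S: "\<And>k w. S k w \<le> 1" "\<And>k. safe (gturn p) (closer p k) k (gword p k) (S k)"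
    by metis
  define x where "x n = S (fst (prod_decode n)) (list_decode (snd (prod_decode n)))" for n
  have "(\<lambda>w. x (coord k w)) = S k" for k
    by (simp add: x_def coord_def)
  then have "x \<in> cls (strategies_name p)"
    using S unfolding cls_strategies_name by (simp add: cantor_def x_def)
  then show ?thesis by blast
qed

text \<open>A code c stands for a stage and a finite tree with which the opponent of the closed player
  wins the game with threshold k.\<close>
definition open_cert :: "baire \<Rightarrow> nat \<Rightarrow> nat \<Rightarrow> bool" where
  "open_cert p k c \<longleftrightarrow> 0 \<in> set (list_decode (snd (prod_decode c))) \<and>
     forcing (gturn p) (closer p k) (gword p k) (fst (prod_decode c)) (list_decode (snd (prod_decode c)))"

lemma ex_open_cert:
  "(\<exists>c. open_cert p k c) \<longleftrightarrow> (\<exists>t T. forcing (gturn p) (closer p k) (gword p k) t T \<and> 0 \<in> set T)"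
proof
  assume "\<exists>t T. forcing (gturn p) (closer p k) (gword p k) t T \<and> 0 \<in> set T"
  then obtain t T where "forcing (gturn p) (closer p k) (gword p k) t T" "0 \<in> set T" by blast
  then have "open_cert p k (pair t (list_encode T))" by (simp add: open_cert_def)
  then show "\<exists>c. open_cert p k c" ..
qed (auto simp: open_cert_def)

text \<open>Sequence \<open>k\<close> is zero exactly if the open player has no certificate, so the
  answer 1 of LPO means a win of the closed player. The bounds on \<open>k\<close> and
  \<open>c\<close> are those of \<open>le_slot\<close>.\<close>

definition LPO_name :: "baire \<Rightarrow> baire" where
  "LPO_name p n = (if n = 0 then gnum p
     else if \<exists>k\<le>n. \<exists>c\<le>n. n = Suc (slot k c) \<and> k < gnum p \<and> open_cert p k c then 1 else 0)"

lemma LPO_name_0: "LPO_name p 0 = gnum p"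
  by (simp add: LPO_name_def)

lemma LPO_name_slot: "k < gnum p \<Longrightarrow> LPO_name p (Suc (slot k c)) = (if open_cert p k c then 1 else 0)"
  using le_slot(1)[of k c] le_slot(2)[of c k] unfolding LPO_name_def by (auto simp: slot_inject le_Suc_eq)

definition value_instance :: "baire \<Rightarrow> baire" where
  "value_instance p n = (if even n then strategies_name p (n div 2) else LPO_name p (n div 2))"

lemma value_instance_eq: "value_instance p = bpair (strategies_name p) (LPO_name p)"
  by (simp add: value_instance_def bpair_def fun_eq_iff)

text \<open>This gives membership in \<open>pdom\<close>: the closed set was designed to be
  nonempty, and each sequence of \<open>LPO_name p\<close> takes values 0 and 1.\<close>

lemma ex_value_solution: "\<exists>y. (C_cantor \<times>\<^sub>W pstar LPO) (value_instance p) y"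
proof -
  obtain x where "x \<in> cls (strategies_name p)"
    using cls_strategies_nonempty by blast
  define Q where "Q n = (if \<exists>k. n = slot k 0 \<and> (\<exists>c. LPO_name p (Suc (slot k c)) \<noteq> 0) then 0 else 1 :: nat)" for n
  have "Q (slot k 0) = (if \<forall>n. LPO_name p (Suc (slot k n)) = 0 then 1 else 0)" for k
    by (auto simp: Q_def slot_inject)
  moreover have "cantor (\<lambda>n. LPO_name p (Suc (slot k n)))" if "k < LPO_name p 0" for k
    using that by (simp add: cantor_def LPO_name_0 LPO_name_slot)
  ultimately have "pstar LPO (LPO_name p) Q"
    unfolding pstar_LPO_iff by blast
  then have "(C_cantor \<times>\<^sub>W pstar LPO) (value_instance p) (bpair x Q)"
    using \<open>x \<in> _\<close> unfolding pprod_def value_instance_eq C_cantor_def by auto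
  then show ?thesis by blast
qed

definition closed_wins :: "baire \<Rightarrow> nat \<Rightarrow> bool" where
  "closed_wins y k \<longleftrightarrow> bsnd y (slot k 0) = 1"

lemma value_solutionD:
  assumes "(C_cantor \<times>\<^sub>W pstar LPO) (value_instance p) y"
  shows "bfst y \<in> cls (strategies_name p)"
    "k < gnum p \<Longrightarrow> closed_wins y k \<longleftrightarrow> \<not> (\<exists>c. open_cert p k c)"
proof -
  show "bfst y \<in> cls (strategies_name p)"
    using assms unfolding pprod_def value_instance_eq C_cantor_def by simp
  assume k: "k < gnum p"
  have "pstar LPO (LPO_name p) (bsnd y)"
    using assms unfolding pprod_def value_instance_eq by simp
  then have "bsnd y (slot k 0) = (if \<forall>n. LPO_name p (Suc (slot k n)) = 0 then 1 else 0)"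
    using k unfolding pstar_LPO_iff LPO_name_0 by blast
  then show "closed_wins y k \<longleftrightarrow> \<not> (\<exists>c. open_cert p k c)"
    unfolding closed_wins_def LPO_name_slot[OF k] by auto
qed

definition winning :: "baire \<Rightarrow> nat \<Rightarrow> nat \<Rightarrow> nat list \<Rightarrow> nat" where
  "winning y k c w = (if closed_wins y k then bfst y (coord k w)
     else tree_strategy (list_decode (snd (prod_decode c))) w)"

text \<open>With tag 1 the closed player is player 1, with tag 0 player 2; in the second case player
  1 wins exactly if the closed player does not.\<close>

definition wins1 :: "baire \<Rightarrow> baire \<Rightarrow> nat \<Rightarrow> bool" where
  "wins1 p y k \<longleftrightarrow> (gname p k 0 = 1 \<longleftrightarrow> closed_wins y k)"

definition ready :: "baire \<Rightarrow> baire \<Rightarrow> nat \<Rightarrow> nat \<Rightarrow> bool" where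
  "ready p y k c \<longleftrightarrow> k < gnum p \<and> (closed_wins y k \<or> open_cert p k c)"

definition gmax :: "baire \<Rightarrow> nat \<Rightarrow> bool" where
  "gmax p k \<longleftrightarrow> (\<forall>j<gnum p. \<not> gpref p k j)"

text \<open>\<open>k\<close> is to be the value of the game and \<open>l\<close> the next better
  outcome for player 1; \<open>c\<close> and \<open>e\<close> supply trees where the open player
  wins. If \<open>k\<close> is the best outcome, \<open>l\<close> and \<open>e\<close> are left
  free.\<close>

definition NE_search :: "baire \<Rightarrow> baire \<Rightarrow> nat \<Rightarrow> nat \<Rightarrow> nat \<Rightarrow> nat \<Rightarrow> bool" where
  "NE_search p y k l c e \<longleftrightarrow> ready p y k c \<and> wins1 p y k \<and>
     (gmax p k \<or> ready p y l e \<and> \<not> wins1 p y l \<and> gpref p k l \<and>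
        (\<forall>j<gnum p. gpref p k j \<longrightarrow> j = l \<or> gpref p l j))"

text \<open>Player 1 plays to reach at least \<open>k\<close>, player 2 to prevent \<open>l\<close>
  or better. If nothing is better than \<open>k\<close>, every move of player 2 is optimal, hence
  the default 0.\<close>

definition NE_profile :: "baire \<Rightarrow> baire \<Rightarrow> nat \<Rightarrow> nat \<Rightarrow> nat \<Rightarrow> nat \<Rightarrow> nat list \<Rightarrow> nat" where
  "NE_profile p y k l c e w = (if gturn p w = 1 then winning y k c w
     else if gmax p k then 0 else winning y l e w)"

lemma strict_linear_ex_max:
  assumes "strict_linear m R" "A \<subseteq> {..<m}" "A \<noteq> {}"
  shows "\<exists>a\<in>A. \<forall>b\<in>A. b = a \<or> R b a"
proof -
  have "finite A" using assms(2) finite_subset by blast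
  then show ?thesis using assms(3,2)
  proof (induction A rule: finite_ne_induct)
    case (insert x A)
    then obtain a where a: "a \<in> A" "\<forall>b\<in>A. b = a \<or> R b a" by auto
    have "x \<noteq> a" using insert.hyps a(1) by blast
    then have "R x a \<or> R a x"
      using assms(1) insert.prems a(1) unfolding strict_linear_def by blast
    then show ?case
    proof
      assume "R x a"
      with a show ?thesis by blast
    next
      assume "R a x"
      then have "\<forall>b\<in>A. R b x"
        using a(2) assms(1) unfolding strict_linear_def by metis
      then show ?thesis by blast
    qed
  qed simp
qed

lemma strict_linear_converse: "strict_linear m R \<Longrightarrow> strict_linear m (\<lambda>i j. R j i)"
  unfolding strict_linear_def by blast

section \<open>Correctness for a fixed game and a fixed solution\<close>

context
  fixes p m d r v
  assumes game: "game_name p m d r v"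
begin

lemma game_gnum: "m = gnum p"
  using game unfolding game_name_def bcomp_def gnum_def by blast

lemma game_turn: "bword w \<Longrightarrow> d w = gturn p w" "bword w \<Longrightarrow> gturn p w \<in> {1, 2}"
  using game unfolding game_name_def bcomp_def gturn_def by metis+

lemma game_pref: "r 1 = gpref p" "r 2 = (\<lambda>i j. gpref p j i)"
proof -
  have "r 1 i j \<longleftrightarrow> i < m \<and> j < m \<and> p (pair (1 + 1) (pair i j)) = 1" for i j
    using game unfolding game_name_def bcomp_def by blast
  then show "r 1 = gpref p"
    unfolding fun_eq_iff gpref_def game_gnum one_add_one by blast
  moreover have "r 2 i j \<longleftrightarrow> r 1 j i" for i j
    using game unfolding game_name_def by blast
  ultimately show "r 2 = (\<lambda>i j. gpref p j i)" by (simp add: fun_eq_iff)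
qed

lemma game_linear: "strict_linear (gnum p) (gpref p)"
  using game unfolding game_name_def game_pref(1)[symmetric] game_gnum[symmetric] by blast

lemma game_set: "OA_name (gname p k) {x. cantor x \<and> v x \<in> gup p k}"
proof -
  have "upper m (r 1) (gup p k)"
    using game_linear unfolding upper_def gup_def game_gnum game_pref strict_linear_def by blast
  then have "OA_name (bcomp (pair 1 (setcode (gup p k))) (bcomp 4 p)) {x. cantor x \<and> v x \<in> gup p k}"
    using game unfolding game_name_def by blast
  then show ?thesis
    unfolding setcode_gup bcomp_def gname_def .
qed

lemma game_tag: "gname p k 0 = 0 \<or> gname p k 0 = 1"
  using game_set[of k] unfolding OA_name_def by auto

lemma game_val_iff:
  assumes "cantor x" shows "v x \<in> gup p k \<longleftrightarrow> (gname p k 0 = 0 \<longleftrightarrow> x \<in> opn (gword p k))"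
proof -
  define S where "S = {x. cantor x \<and> v x \<in> gup p k}"
  have x: "x \<in> S \<longleftrightarrow> v x \<in> gup p k" "x \<in> cls (gword p k) \<longleftrightarrow> x \<notin> opn (gword p k)"
    using assms by (simp_all add: S_def cls_def)
  have "(\<lambda>n. gname p k (Suc n)) = gword p k"
    by (simp add: gword_def fun_eq_iff)
  with game_set[of k] have "gname p k 0 = 0 \<and> S = opn (gword p k) \<or> gname p k 0 = 1 \<and> S = cls (gword p k)"
    unfolding OA_name_def S_def by simp
  then show ?thesis
  proof
    assume "gname p k 0 = 0 \<and> S = opn (gword p k)"
    with x show ?thesis by simp
  next
    assume "gname p k 0 = 1 \<and> S = cls (gword p k)"
    with x show ?thesis by simp
  qed
qed

context
  fixes y
  assumes solution: "(C_cantor \<times>\<^sub>W pstar LPO) (value_instance p) y"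
begin

lemma winning_le: "winning y k c w \<le> 1"
  using value_solutionD(1)[OF solution] unfolding winning_def tree_strategy_def cls_def cantor_def by simp

text \<open>A win of the closed player excludes forcing trees, so by
  \<open>safe_imp_not_hits\<close> the stored strategy hits no listed word, whereas a play in the
  open set would make it hit one.\<close>

lemma winning_closed:
  assumes "ready p y k c" "closed_wins y k" and s: "strategy s"
    and s_win: "\<And>w. bword w \<Longrightarrow> gturn p w = closer p k \<Longrightarrow> s w = winning y k c w"
  shows "play s \<notin> opn (gword p k)"
proof
  have k: "k < gnum p" using assms(1) by (simp add: ready_def)
  assume "play s \<in> opn (gword p k)"
  then obtain n e where n: "gword p k n = Suc e" "extends (play s) (list_decode e)"
    unfolding opn_def by blast
  have "hits (gturn p) (closer p k) (\<lambda>w. bfst y (coord k w)) (list_decode e)"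
    using s _ n(2) by (rule hits_play) (simp add: s_win winning_def assms(2))
  moreover have "safe (gturn p) (closer p k) k (gword p k) (\<lambda>w. bfst y (coord k w))"
    using value_solutionD(1)[OF solution] k unfolding cls_strategies_name by blast
  moreover have "\<not> (\<exists>t T. forcing (gturn p) (closer p k) (gword p k) t T \<and> 0 \<in> set T)"
    using value_solutionD(2)[OF solution k] assms(2) unfolding ex_open_cert by blast
  ultimately show False
    using safe_imp_not_hits[of "gturn p" "closer p k" k "gword p k" "\<lambda>w. bfst y (coord k w)" n] n(1) by simp
qed

lemma winning_open:
  assumes "ready p y k c" "\<not> closed_wins y k" and s: "strategy s"
    and s_win: "\<And>w. bword w \<Longrightarrow> gturn p w \<noteq> closer p k \<Longrightarrow> s w = winning y k c w"
  shows "play s \<in> opn (gword p k)"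
proof -
  have "open_cert p k c" using assms(1,2) by (simp add: ready_def)
  then have "forcing (gturn p) (closer p k) (gword p k) (fst (prod_decode c)) (list_decode (snd (prod_decode c)))"
    "0 \<in> set (list_decode (snd (prod_decode c)))"
    by (simp_all add: open_cert_def)
  then have "\<exists>i\<le>fst (prod_decode c). gword p k i \<noteq> 0 \<and> extends (play s) (list_decode (gword p k i - 1))"
    using s
  proof (rule forcing_play)
    fix w assume "bword w" "gturn p w \<noteq> closer p k"
    then show "s w = tree_strategy (list_decode (snd (prod_decode c))) w"
      using s_win[of w] assms(2) by (simp add: winning_def)
  qed
  then obtain i where i: "gword p k i \<noteq> 0" "extends (play s) (list_decode (gword p k i - 1))" by blast
  then have "gword p k i = Suc (gword p k i - 1)" by simp
  with i(2) show ?thesis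
    using cantor_play[OF s] unfolding opn_def by blast
qed

lemma wins1_value:
  assumes "ready p y k c" "wins1 p y k" and s: "strategy s"
    and s_win: "\<And>w. bword w \<Longrightarrow> gturn p w = 1 \<Longrightarrow> s w = winning y k c w"
  shows "v (play s) \<in> gup p k"
proof (cases "closed_wins y k")
  case True
  then have tag: "gname p k 0 = 1" using assms(2) by (simp add: wins1_def)
  have "play s \<notin> opn (gword p k)"
    using assms(1) True s by (rule winning_closed) (simp add: closer_def tag s_win)
  with tag show ?thesis
    unfolding game_val_iff[OF cantor_play[OF s]] by simp
next
  case False
  then have tag: "gname p k 0 = 0" using assms(2) game_tag[of k] by (auto simp: wins1_def)
  have "gturn p w = 1" if "bword w" "gturn p w \<noteq> 2" for w
    using game_turn(2)[OF that(1)] that(2) by blast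
  then have "play s \<in> opn (gword p k)"
    using assms(1) False s by (intro winning_open) (auto simp: closer_def tag s_win)
  with tag show ?thesis
    unfolding game_val_iff[OF cantor_play[OF s]] by simp
qed

lemma not_wins1_value:
  assumes "ready p y k c" "\<not> wins1 p y k" and s: "strategy s"
    and s_win: "\<And>w. bword w \<Longrightarrow> gturn p w = 2 \<Longrightarrow> s w = winning y k c w"
  shows "v (play s) \<notin> gup p k"
proof (cases "closed_wins y k")
  case True
  then have tag: "gname p k 0 = 0" using assms(2) game_tag[of k] by (auto simp: wins1_def)
  have "play s \<notin> opn (gword p k)"
    using assms(1) True s by (rule winning_closed) (simp add: closer_def tag s_win)
  with tag show ?thesis
    unfolding game_val_iff[OF cantor_play[OF s]] by simp
next
  case False
  then have tag: "gname p k 0 = 1" using assms(2) by (simp add: wins1_def)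
  have "gturn p w = 2" if "bword w" "gturn p w \<noteq> 1" for w
    using game_turn(2)[OF that(1)] that(2) by blast
  then have "play s \<in> opn (gword p k)"
    using assms(1) False s by (intro winning_open) (auto simp: closer_def tag s_win)
  with tag show ?thesis
    unfolding game_val_iff[OF cantor_play[OF s]] by simp
qed

lemma ex_ready:
  assumes "k < gnum p" obtains c where "ready p y k c"
  using value_solutionD(2)[OF solution assms] assms unfolding ready_def by blast

lemma ex_NE_search: "\<exists>k l c e. NE_search p y k l c e"
proof -
  have "1 \<le> gnum p"
    using game unfolding game_name_def game_gnum[symmetric] by blast
  then have "{..<gnum p} \<noteq> {}" by (auto simp: lessThan_empty_iff)
  then obtain b where b: "b < gnum p" "\<And>j. j < gnum p \<Longrightarrow> j = b \<or> gpref p b j"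
    using strict_linear_ex_max[OF strict_linear_converse[OF game_linear], of "{..<gnum p}"] by blast
  obtain cb where cb: "ready p y b cb" using ex_ready[OF b(1)] .
  have s: "strategy (winning y b cb)"
    using winning_le by (simp add: strategy_def)
  have "v x \<in> gup p b" if "cantor x" for x
    using game that b(2) unfolding gup_def game_name_def game_gnum[symmetric] by blast
  \<comment> \<open>\<open>b\<close> is the worst outcome for player 1, so every play has a value in
    \<open>gup p b\<close>; were \<open>wins1\<close> false, \<open>not_wins1_value\<close> would
    exhibit a play outside.\<close>
  then have "wins1 p y b"
    using not_wins1_value[OF cb _ s] cantor_play[OF s] by blast
  with b(1) have "{k. k < gnum p \<and> wins1 p y k} \<noteq> {}" by blast
  then obtain k where k: "k < gnum p" "wins1 p y k" "\<And>j. j < gnum p \<Longrightarrow> wins1 p y j \<Longrightarrow> j = k \<or> gpref p j k"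
    using strict_linear_ex_max[OF game_linear, of "{k. k < gnum p \<and> wins1 p y k}"] by blast
  obtain c where c: "ready p y k c" using ex_ready[OF k(1)] .
  show ?thesis
  proof (cases "gmax p k")
    case True
    with c k(2) show ?thesis unfolding NE_search_def by blast
  next
    case False
    then have "{j. j < gnum p \<and> gpref p k j} \<noteq> {}" unfolding gmax_def by blast
    then obtain l where l: "l < gnum p" "gpref p k l"
      "\<And>j. j < gnum p \<Longrightarrow> gpref p k j \<Longrightarrow> j = l \<or> gpref p l j"
      using strict_linear_ex_max[OF strict_linear_converse[OF game_linear], of "{j. j < gnum p \<and> gpref p k j}"]
      by blast
    have "\<not> wins1 p y l"
      using k(3)[OF l(1)] l(2) game_linear unfolding strict_linear_def by metis
    moreover obtain e where "ready p y l e" using ex_ready[OF l(1)] .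
    ultimately show ?thesis
      using c k(2) l unfolding NE_search_def by blast
  qed
qed

lemma NE_search_nash:
  assumes "NE_search p y k l c e" and q: "\<And>w. s w = NE_profile p y k l c e w"
  shows "nash d r v s"
proof -
  have k: "ready p y k c" "wins1 p y k"
    using assms(1) unfolding NE_search_def by auto
  have s: "strategy s"
    using winning_le by (simp add: strategy_def q NE_profile_def)
  have up: "v (play s') \<in> gup p k"
    if "strategy s'" "\<And>w. bword w \<Longrightarrow> d w \<noteq> 2 \<Longrightarrow> s' w = s w" for s'
    using k that(1)
  proof (rule wins1_value)
    fix w assume "bword w" "gturn p w = 1"
    then show "s' w = winning y k c w"
      using that(2)[of w] game_turn(1)[of w] by (simp add: q NE_profile_def)
  qed
  have below: "\<not> gpref p k (v (play s'))"
    if "strategy s'" "\<And>w. bword w \<Longrightarrow> d w \<noteq> 1 \<Longrightarrow> s' w = s w" for s'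
  proof (cases "gmax p k")
    case True
    then show ?thesis unfolding gmax_def gpref_def by blast
  next
    case False
    then have l: "ready p y l e" "\<not> wins1 p y l"
      and next_l: "\<And>j. j < gnum p \<Longrightarrow> gpref p k j \<Longrightarrow> j = l \<or> gpref p l j"
      using assms(1) unfolding NE_search_def by auto
    have "v (play s') \<notin> gup p l"
      using l that(1)
    proof (rule not_wins1_value)
      fix w assume "bword w" "gturn p w = 2"
      then show "s' w = winning y l e w"
        using that(2)[of w] game_turn(1)[of w] False by (simp add: q NE_profile_def)
    qed
    then show ?thesis
      using next_l unfolding gup_def gpref_def by blast
  qed
  \<comment> \<open>\<open>up\<close> covers deviations of player 2 and \<open>below\<close> those
    of player 1. The profile itself is a trivial deviation of either kind, so its value is exactly
    \<open>k\<close>.\<close>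
  have val: "v (play s) = k"
    using up[OF s] below[OF s] unfolding gup_def by auto
  have "\<not> r 1 (v (play s)) (v (play s'))"
    if "strategy s'" "\<forall>w. bword w \<and> d w \<noteq> 1 \<longrightarrow> s' w = s w" for s'
    unfolding val game_pref using below[OF that(1)] that(2) by blast
  moreover have "\<not> r 2 (v (play s)) (v (play s'))"
    if "strategy s'" "\<forall>w. bword w \<and> d w \<noteq> 2 \<longrightarrow> s' w = s w" for s'
  proof -
    have "v (play s') = k \<or> gpref p k (v (play s'))"
      using up[OF that(1)] that(2) unfolding gup_def by blast
    then show ?thesis
      unfolding val game_pref using game_linear unfolding strict_linear_def by metis
  qed
  ultimately show ?thesis
    using s unfolding nash_def by auto
qed

end

end

section \<open>Computability of the instance and of the equilibrium search\<close>

lemma computable_gnum: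
  assumes "computable P" shows "computable (\<lambda>p x. gnum (P p))"
  unfolding gnum_def by (intro computable_compose[OF assms] computable_intros)

lemma computable_gturn:
  assumes "computable P" "computable f" shows "computable (\<lambda>p x. gturn (P p) (f p x))"
  unfolding gturn_def by (intro computable_compose[OF assms(1)] computable_intros assms)

lemma computable_gpref:
  assumes "computable P" "computable f" "computable g"
  shows "computable (\<lambda>p x. gpref (P p) (f p x) (g p x))"
  unfolding gpref_def by (intro computable_compose[OF assms(1)] computable_intros computable_gnum assms)

lemma computable_gname:
  assumes "computable P" "computable f" "computable g"
  shows "computable (\<lambda>p x. gname (P p) (f p x) (g p x))"
  unfolding gname_def
  by (intro computable_compose[OF assms(1)] computable_intros computable_gnum computable_gpref
      computable_compose[OF assms(2)] assms)

lemma computable_gword: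
  assumes "computable P" "computable f" "computable g"
  shows "computable (\<lambda>p x. gword (P p) (f p x) (g p x))"
  unfolding gword_def by (intro computable_gname computable_intros assms)

lemma computable_closer:
  assumes "computable P" "computable f" shows "computable (\<lambda>p x. closer (P p) (f p x))"
  unfolding closer_def by (intro computable_gname computable_intros assms)

lemma computable_coord:
  "computable f \<Longrightarrow> computable g \<Longrightarrow> computable (\<lambda>p x. coord (f p x) (g p x))"
  unfolding coord_def by (intro computable_intros)

lemma computable_prefix_hits:
  assumes "computable k" "computable z" "computable u"
  shows "computable (\<lambda>p x. prefix_hits (gturn p) (closer p (k p x)) (k p x) (z p x) (u p x))"
  unfolding prefix_hits_def
  by (intro computable_intros computable_bword computable_gturn computable_closer computable_coord
      computable_oracle computable_compose[OF assms(1)] computable_compose[OF assms(2)]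
      computable_compose[OF assms(3)] assms)

lemma computable_prefix_misses:
  assumes "computable k" "computable z" "computable u"
  shows "computable (\<lambda>p x. prefix_misses (gturn p) (closer p (k p x)) (k p x) (z p x) (u p x))"
  unfolding prefix_misses_def
  by (intro computable_intros computable_bword computable_gturn computable_closer computable_coord
      computable_oracle computable_compose[OF assms(1)] computable_compose[OF assms(2)]
      computable_compose[OF assms(3)] assms)

lemma computable_avoidable:
  assumes "computable k" "computable t" "computable \<sigma>"
  shows "computable (\<lambda>p x. avoidable (gturn p) (closer p (k p x)) (k p x) (gword p (k p x)) (t p x) (\<sigma> p x))"
  unfolding avoidable_def
  by (intro computable_intros computable_bword computable_prefix_misses computable_gword
      computable_oracle computable_compose[OF assms(1)] computable_compose[OF assms(2)]
      computable_compose[OF assms(3)] assms)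

lemma computable_strategies_name: "computable strategies_name"
  unfolding strategies_name_def strategy_entry_def
  by (intro computable_intros computable_gnum computable_avoidable computable_prefix_hits
      computable_gword computable_oracle)

lemma computable_covered:
  assumes "computable P" "computable k" "computable t" "computable u"
  shows "computable (\<lambda>p x. covered (gword (P p) (k p x)) (t p x) (u p x))"
  unfolding covered_def
  by (intro computable_intros computable_gword computable_compose[OF assms(2)]
      computable_compose[OF assms(3)] computable_compose[OF assms(4)] assms)

lemma computable_open_cert:
  assumes "computable P" "computable k" "computable c"
  shows "computable (\<lambda>p x. open_cert (P p) (k p x) (c p x))"
  unfolding open_cert_def forcing_def
  by (intro computable_intros computable_covered computable_gturn computable_closer
      computable_compose[OF assms(2)] computable_compose[OF assms(3)] assms)

lemma computable_LPO_name: "computable LPO_name"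
  unfolding LPO_name_def
  by (intro computable_intros computable_gnum computable_slot computable_open_cert computable_oracle)

lemma computable_value_instance: "computable value_instance"
  unfolding value_instance_def
  by (intro computable_intros computable_compose[OF computable_strategies_name]
      computable_compose[OF computable_LPO_name])

lemma computable_closed_wins:
  assumes "computable Y" "computable k" shows "computable (\<lambda>p x. closed_wins (Y p) (k p x))"
  unfolding closed_wins_def bsnd_def
  by (intro computable_compose[OF assms(1)] computable_intros computable_slot assms)

lemma computable_winning:
  assumes "computable Y" "computable k" "computable c" "computable w"
  shows "computable (\<lambda>p x. winning (Y p) (k p x) (c p x) (w p x))"
  unfolding winning_def tree_strategy_def bfst_def
  by (intro computable_compose[OF assms(1)] computable_intros computable_closed_wins computable_coord assms)

lemma computable_ready:
  assumes "computable P" "computable Y" "computable k" "computable c"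
  shows "computable (\<lambda>p x. ready (P p) (Y p) (k p x) (c p x))"
  unfolding ready_def
  by (intro computable_intros computable_gnum computable_closed_wins computable_open_cert assms)

lemma computable_wins1:
  assumes "computable P" "computable Y" "computable k"
  shows "computable (\<lambda>p x. wins1 (P p) (Y p) (k p x))"
  unfolding wins1_def by (intro computable_intros computable_gname computable_closed_wins assms)

lemma computable_gmax:
  assumes "computable P" "computable k" shows "computable (\<lambda>p x. gmax (P p) (k p x))"
  unfolding gmax_def
  by (intro computable_intros computable_gnum computable_gpref computable_compose[OF assms(2)] assms)

definition NE_ok :: "baire \<Rightarrow> nat \<Rightarrow> bool" where
  "NE_ok z t \<longleftrightarrow> NE_search (bfst z) (bsnd z) (fst (prod_decode (fst (prod_decode t))))
     (snd (prod_decode (fst (prod_decode t)))) (fst (prod_decode (snd (prod_decode t))))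
     (snd (prod_decode (snd (prod_decode t))))"

definition NE_out :: "baire \<Rightarrow> nat \<Rightarrow> nat \<Rightarrow> nat" where
  "NE_out z t n = NE_profile (bfst z) (bsnd z) (fst (prod_decode (fst (prod_decode t))))
     (snd (prod_decode (fst (prod_decode t)))) (fst (prod_decode (snd (prod_decode t))))
     (snd (prod_decode (snd (prod_decode t)))) (list_decode n)"

lemma computable_NE_ok: "computable NE_ok"
  unfolding NE_ok_def NE_search_def
  by (intro computable_intros computable_gnum computable_gpref computable_gmax computable_wins1
      computable_ready computable_bfst computable_bsnd)

lemma computable_NE_out: "computable (\<lambda>p z. NE_out p (fst z) (snd z))"
  unfolding NE_out_def NE_profile_def
  by (intro computable_intros computable_gturn computable_gmax computable_winning computable_bfst
      computable_bsnd)

theorem NE_le_C_LPO: "NE_ap_OA \<le>\<^sub>W (C_cantor \<times>\<^sub>W pstar LPO)"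
proof -
  obtain eH where H: "\<And>p. machine_out eH p (value_instance p)"
    using machine_total_out[OF computable_value_instance] by blast
  obtain eK where K: "\<And>z. \<exists>t. NE_ok z t \<Longrightarrow> machine_out eK z (NE_out z (LEAST t. NE_ok z t))"
    using machine_search_out[OF computable_NE_ok computable_NE_out] by blast
  have "\<exists>h. machine_out eH p h \<and> h \<in> pdom (C_cantor \<times>\<^sub>W pstar LPO) \<and>
      (\<exists>q. machine_out eK (bpair p (G h)) q \<and> NE_ap_OA p q)"
    if G: "realizer (C_cantor \<times>\<^sub>W pstar LPO) G" and p: "p \<in> pdom NE_ap_OA" for G p
  proof -
    obtain m d r v where game: "game_name p m d r v"
      using p unfolding pdom_def NE_ap_OA_def by blast
    have dom: "value_instance p \<in> pdom (C_cantor \<times>\<^sub>W pstar LPO)"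
      using ex_value_solution unfolding pdom_def by blast
    define y where "y = G (value_instance p)"
    have y: "(C_cantor \<times>\<^sub>W pstar LPO) (value_instance p) y"
      using G dom unfolding realizer_def y_def by blast
    obtain k l c e where "NE_search p y k l c e"
      using ex_NE_search[OF game y] by blast
    then have "NE_ok (bpair p y) (pair (pair k l) (pair c e))"
      by (simp add: NE_ok_def)
    then have ex: "\<exists>t. NE_ok (bpair p y) t" by blast
    then have "NE_ok (bpair p y) (LEAST t. NE_ok (bpair p y) t)"
      by (rule LeastI_ex)
    \<comment> \<open>Every quadruple accepted by the search yields an equilibrium, so it does not
      matter which of them the machine meets first.\<close>
    then have "nash d r v (strat (NE_out (bpair p y) (LEAST t. NE_ok (bpair p y) t)))"
      unfolding NE_ok_def bfst_bpair bsnd_bpair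
      by (rule NE_search_nash[OF game y]) (simp add: NE_out_def)
    then have "NE_ap_OA p (NE_out (bpair p y) (LEAST t. NE_ok (bpair p y) t))"
      using game unfolding NE_ap_OA_def by blast
    then show ?thesis
      using H dom K[OF ex] unfolding y_def by blast
  qed
  then show ?thesis
    unfolding weihrauch_le_def by blast
qed

theorem theorem29:
  shows "NE_ap_OA \<equiv>\<^sub>W (C_cantor \<times>\<^sub>W pstar LPO)"
  unfolding weihrauch_eq_def using NE_le_C_LPO C_LPO_le_NE by blast

end
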